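(* Let $\Bbbk$ be an algebraically closed field of characteristic zero, let $q\in\Bbbk^\ast\setminus\{1\}$, and let $A_q^1(\Bbbk)=\Bbbk\langle X,Y\mid YX-qXY=1\rangle$. Let $H$ be the derivation of $A_q^1(\Bbbk)$ determined by $H(X)=X$, $H(Y)=-Y$. A derivation $D\in\mathrm{Der}(A_q^1(\Bbbk))$ is locally finite if and only if $D=cH$ for some $c\in\Bbbk$. Then $$\mathrm{LFD}(A_q^1(\Bbbk))=\Bbbk H.$$ Moreover, $\mathrm{LND}(A_q^1(\Bbbk))=\{0\}$.
   Context: $\mathrm{Der}(A)$ denotes the set of $\Bbbk$-linear derivations of a $\Bbbk$-algebra $A$. A derivation $D$ of $A$ is locally finite if for every $a\in A$ the space $\mathrm{Span}_\Bbbk\{D^n(a)\mid n\ge0\}$ is finite-dimensional, and locally nilpotent if for every $a\in A$ there is $n\ge1$ with $D^n(a)=0$. $\mathrm{LFD}(A)$ and $\mathrm{LND}(A)$ denote the sets of locally finite and locally nilpotent derivations of $A$, respectively. The case where $q\neq1$ is a root of unity is included. *)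

theory Defs
  imports
    "HOL-Algebra.Algebra"
    "HOL-Algebra.Algebraic_Closure_Type"
    "HOL-Library.Poly_Mapping"
begin

section \<open>Algebras over a field and their derivations\<close>

text \<open>
  The ground field is a type \<open>'k\<close> of class \<^class>\<open>field\<close>. A not necessarily commutative
  \<open>'k\<close>-algebra is carried by a record of type \<^typ>\<open>('k, 'a) module\<close>; the library locale
  \<^locale>\<open>algebra\<close> is not used, since it demands commutativity. Maps on an algebra are
  extensional functions on the carrier, so that equality of maps is equality in HOL.
\<close>

definition derivations :: "('k::field, 'a) module \<Rightarrow> ('a \<Rightarrow> 'a) set" where
  "derivations A = {D \<in> carrier A \<rightarrow>\<^sub>E carrier A.
     (\<forall>a\<in>carrier A. \<forall>b\<in>carrier A. D (a \<oplus>\<^bsub>A\<^esub> b) = D a \<oplus>\<^bsub>A\<^esub> D b) \<and>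
     (\<forall>c. \<forall>a\<in>carrier A. D (c \<odot>\<^bsub>A\<^esub> a) = c \<odot>\<^bsub>A\<^esub> D a) \<and>
     (\<forall>a\<in>carrier A. \<forall>b\<in>carrier A. D (a \<otimes>\<^bsub>A\<^esub> b) = (D a \<otimes>\<^bsub>A\<^esub> b) \<oplus>\<^bsub>A\<^esub> (a \<otimes>\<^bsub>A\<^esub> D b))}"

definition lin_span :: "('k::field, 'a) module \<Rightarrow> 'a set \<Rightarrow> 'a set" where
  "lin_span A S = \<Inter>{V. submodule V (ring_of_type_algebra :: 'k ring) A \<and> S \<subseteq> V}"

definition finite_dim :: "('k::field, 'a) module \<Rightarrow> 'a set \<Rightarrow> bool" where
  "finite_dim A V \<longleftrightarrow> (\<exists>B. finite B \<and> B \<subseteq> carrier A \<and> V = lin_span A B)"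

definition locally_finite :: "('k::field, 'a) module \<Rightarrow> ('a \<Rightarrow> 'a) \<Rightarrow> bool" where
  "locally_finite A D \<longleftrightarrow> (\<forall>a\<in>carrier A. finite_dim A (lin_span A {(D ^^ n) a | n. n \<ge> 0}))"

definition locally_nilpotent :: "('k::field, 'a) module \<Rightarrow> ('a \<Rightarrow> 'a) \<Rightarrow> bool" where
  "locally_nilpotent A D \<longleftrightarrow> (\<forall>a\<in>carrier A. \<exists>n\<ge>1. (D ^^ n) a = \<zero>\<^bsub>A\<^esub>)"

definition LFD :: "('k::field, 'a) module \<Rightarrow> ('a \<Rightarrow> 'a) set" where
  "LFD A = {D \<in> derivations A. locally_finite A D}"

definition LND :: "('k::field, 'a) module \<Rightarrow> ('a \<Rightarrow> 'a) set" where
  "LND A = {D \<in> derivations A. locally_nilpotent A D}"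

definition scale_map :: "('k::field, 'a) module \<Rightarrow> 'k \<Rightarrow> ('a \<Rightarrow> 'a) \<Rightarrow> 'a \<Rightarrow> 'a" where
  "scale_map A c D = (\<lambda>a\<in>carrier A. c \<odot>\<^bsub>A\<^esub> D a)"

definition zero_map :: "('k::field, 'a) module \<Rightarrow> 'a \<Rightarrow> 'a" where
  "zero_map A = (\<lambda>a\<in>carrier A. \<zero>\<^bsub>A\<^esub>)"


section \<open>Free algebras\<close>

text \<open>
  Words are wrapped in a datatype in order to write concatenation additively: the convolution
  product of \<^theory>\<open>HOL-Library.Poly_Mapping\<close> on finitely supported functions of words is
  then the product of the free associative algebra.
\<close>

datatype 'g free_monoid = Word (letters: "'g list")

instantiation free_monoid :: (type) monoid_add
begin

definition zero_free_monoid :: "'a free_monoid" where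
  "zero_free_monoid = Word []"

definition plus_free_monoid :: "'a free_monoid \<Rightarrow> 'a free_monoid \<Rightarrow> 'a free_monoid" where
  "plus_free_monoid u v = Word (letters u @ letters v)"

instance
  by standard (simp_all add: zero_free_monoid_def plus_free_monoid_def)

end

type_synonym ('g, 'k) free_alg = "'g free_monoid \<Rightarrow>\<^sub>0 'k"

definition const :: "'k::field \<Rightarrow> ('g, 'k) free_alg" where
  "const c = Poly_Mapping.single 0 c"

definition var :: "'g \<Rightarrow> ('g, 'k::field) free_alg" where
  "var g = Poly_Mapping.single (Word [g]) 1"

definition free_algebra :: "('k::field, ('g, 'k) free_alg) module" where
  "free_algebra = \<lparr>carrier = UNIV, monoid.mult = (*), one = 1, ring.zero = 0, add = (+),
     module.smult = (\<lambda>c p. const c * p)\<rparr>"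

text \<open>
  The scalar action on cosets is \<open>c \<odot> (I + a) = I + c \<odot> a\<close>, in the style of
  \<^const>\<open>rcoset_mult\<close>.
\<close>

definition quotient_algebra :: "('k::field, 'a) module \<Rightarrow> 'a set \<Rightarrow> ('k, 'a set) module" where
  "quotient_algebra A I =
     ring.extend (A Quot I) (module.fields (\<lambda>c C. \<Union>a\<in>C. I +>\<^bsub>A\<^esub> (c \<odot>\<^bsub>A\<^esub> a)))"


section \<open>The algebra with generators X, Y and relation YX - qXY = 1\<close>

datatype generator = GenX | GenY

definition qweyl_ideal :: "'k::field \<Rightarrow> (generator, 'k) free_alg set" where
  "qweyl_ideal q =
     Idl\<^bsub>free_algebra\<^esub> {var GenY * var GenX - const q * var GenX * var GenY - 1}"

definition qweyl :: "'k::field \<Rightarrow> ('k, (generator, 'k) free_alg set) module" where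
  "qweyl q = quotient_algebra free_algebra (qweyl_ideal q)"

definition qweyl_X :: "'k::field \<Rightarrow> (generator, 'k) free_alg set" where
  "qweyl_X q = qweyl_ideal q +>\<^bsub>free_algebra\<^esub> var GenX"

definition qweyl_Y :: "'k::field \<Rightarrow> (generator, 'k) free_alg set" where
  "qweyl_Y q = qweyl_ideal q +>\<^bsub>free_algebra\<^esub> var GenY"

text \<open>Existence and uniqueness of this derivation is lemma \<open>qweyl_H_ex1\<close> below.\<close>

definition qweyl_H :: "'k::field \<Rightarrow> (generator, 'k) free_alg set \<Rightarrow> (generator, 'k) free_alg set" where
  "qweyl_H q = (THE D. D \<in> derivations (qweyl q) \<and>
     D (qweyl_X q) = qweyl_X q \<and> D (qweyl_Y q) = \<ominus>\<^bsub>qweyl q\<^esub> qweyl_Y q)"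


section \<open>The definitions are consistent\<close>

lemma free_algebra_simps [simp]:
  "carrier (free_algebra :: ('k::field, ('g, 'k) free_alg) module) = UNIV"
  "a \<otimes>\<^bsub>free_algebra\<^esub> b = a * b"
  "\<one>\<^bsub>free_algebra\<^esub> = 1"
  "\<zero>\<^bsub>free_algebra\<^esub> = 0"
  "a \<oplus>\<^bsub>free_algebra\<^esub> b = a + b"
  "c \<odot>\<^bsub>free_algebra\<^esub> a = const c * a"
  for a b :: "('g, 'k::field) free_alg"
  by (simp_all add: free_algebra_def)

lemma ring_free_algebra: "ring (free_algebra :: ('k::field, ('g, 'k) free_alg) module)"
proof (rule ringI)
  show "abelian_group (free_algebra :: ('k::field, ('g, 'k) free_alg) module)"
  proof (rule abelian_groupI)
    fix x :: "('g, 'k) free_alg"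
    show "\<exists>y\<in>carrier free_algebra. y \<oplus>\<^bsub>free_algebra\<^esub> x = \<zero>\<^bsub>free_algebra\<^esub>"
      by (rule bexI[of _ "- x"]) simp_all
  qed (simp_all add: algebra_simps)
  show "Group.monoid (free_algebra :: ('k::field, ('g, 'k) free_alg) module)"
    by (rule monoidI) (simp_all add: algebra_simps)
qed (simp_all add: algebra_simps)

lemma free_alg_induct [case_names single add]:
  fixes p :: "('g, 'k::field) free_alg"
  assumes "\<And>w c. P (Poly_Mapping.single w c)"
    and "\<And>p q. P p \<Longrightarrow> P q \<Longrightarrow> P (p + q)"
  shows "P p"
proof (induction p rule: update_induct)
  case const
  show ?case using assms(1)[of 0 0] by simp
next
  case (update p w c)
  have "Poly_Mapping.update w c p = p + Poly_Mapping.single w c"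
    using update by (intro poly_mapping_eqI)
      (auto simp: lookup_add lookup_single lookup_update in_keys_iff when_def)
  then show ?case using assms update by simp
qed

lemma word_add: "Word u + Word v = Word (u @ v)"
  by (simp add: plus_free_monoid_def)

lemma single_Word_Cons:
  "Poly_Mapping.single (Word (g # u)) c = var g * Poly_Mapping.single (Word u) (c :: 'k::field)"
  by (simp add: var_def mult_single word_add)

lemma const_commute: "const c * p = p * const c" for p :: "('g, 'k::field) free_alg"
proof (induction p rule: free_alg_induct)
  case (single w d)
  show ?case by (simp add: const_def mult_single mult.commute)
next
  case (add p q)
  then show ?case by (simp add: algebra_simps)
qed

lemma const_mult: "const (c * d) = const c * const d"
  and const_add: "const (c + d) = const c + const d"
  and const_one: "const 1 = 1"
  by (simp_all add: const_def mult_single single_add)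

lemma ideal_qweyl: "ideal (qweyl_ideal q) free_algebra"
  unfolding qweyl_ideal_def by (rule ring.genideal_ideal[OF ring_free_algebra]) simp

lemma carrier_qweyl: "carrier (qweyl q) = range (\<lambda>p. qweyl_ideal q +>\<^bsub>free_algebra\<^esub> p)"
  by (auto simp: qweyl_def quotient_algebra_def ring.defs module.defs FactRing_def A_RCOSETS_def')

lemma qweyl_one: "\<one>\<^bsub>qweyl q\<^esub> = qweyl_ideal q +>\<^bsub>free_algebra\<^esub> 1"
  by (simp add: qweyl_def quotient_algebra_def ring.defs module.defs FactRing_def)

lemma qweyl_zero: "\<zero>\<^bsub>qweyl q\<^esub> = qweyl_ideal q +>\<^bsub>free_algebra\<^esub> 0"
proof -
  interpret ideal "qweyl_ideal q" free_algebra by (rule ideal_qweyl)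
  show ?thesis
    using a_coset_add_zero[OF a_subset]
    by (simp add: qweyl_def quotient_algebra_def ring.defs module.defs FactRing_def)
qed

lemma qweyl_add:
  "(qweyl_ideal q +>\<^bsub>free_algebra\<^esub> a) \<oplus>\<^bsub>qweyl q\<^esub> (qweyl_ideal q +>\<^bsub>free_algebra\<^esub> b)
     = qweyl_ideal q +>\<^bsub>free_algebra\<^esub> (a + b)"
proof -
  interpret ideal "qweyl_ideal q" free_algebra by (rule ideal_qweyl)
  show ?thesis
    using a_rcos_sum[of a b]
    by (simp add: qweyl_def quotient_algebra_def ring.defs module.defs FactRing_def)
qed

lemma qweyl_mult:
  "(qweyl_ideal q +>\<^bsub>free_algebra\<^esub> a) \<otimes>\<^bsub>qweyl q\<^esub> (qweyl_ideal q +>\<^bsub>free_algebra\<^esub> b)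
     = qweyl_ideal q +>\<^bsub>free_algebra\<^esub> (a * b)"
proof -
  interpret ideal "qweyl_ideal q" free_algebra by (rule ideal_qweyl)
  show ?thesis
    using rcoset_mult_add[of a b]
    by (simp add: qweyl_def quotient_algebra_def ring.defs module.defs FactRing_def)
qed

lemma qweyl_coset_mem_iff:
  "x \<in> qweyl_ideal q +>\<^bsub>free_algebra\<^esub> a \<longleftrightarrow> x - a \<in> qweyl_ideal q"
proof -
  have "x \<in> qweyl_ideal q +>\<^bsub>free_algebra\<^esub> a \<longleftrightarrow> (\<exists>h\<in>qweyl_ideal q. x = h + a)"
    by (auto simp: a_r_coset_def r_coset_def)
  also have "\<dots> \<longleftrightarrow> x - a \<in> qweyl_ideal q"
    by (metis add_diff_cancel_right' diff_add_cancel)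
  finally show ?thesis .
qed

lemma qweyl_ideal_closed:
  "0 \<in> qweyl_ideal q"
  "a \<in> qweyl_ideal q \<Longrightarrow> b \<in> qweyl_ideal q \<Longrightarrow> a + b \<in> qweyl_ideal q"
  "a \<in> qweyl_ideal q \<Longrightarrow> p * a \<in> qweyl_ideal q"
  "a \<in> qweyl_ideal q \<Longrightarrow> a * p \<in> qweyl_ideal q"
  "a \<in> qweyl_ideal q \<Longrightarrow> - a \<in> qweyl_ideal q"
  "a \<in> qweyl_ideal q \<Longrightarrow> b \<in> qweyl_ideal q \<Longrightarrow> a - b \<in> qweyl_ideal q"
proof -
  interpret ideal "qweyl_ideal q" free_algebra by (rule ideal_qweyl)
  show "0 \<in> qweyl_ideal q"
    using additive_subgroup.zero_closed[OF is_additive_subgroup] by simp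
  show add: "a + b \<in> qweyl_ideal q" if "a \<in> qweyl_ideal q" "b \<in> qweyl_ideal q" for a b
    using additive_subgroup.a_closed[OF is_additive_subgroup that] by simp
  show l: "p * a \<in> qweyl_ideal q" if "a \<in> qweyl_ideal q" for a p
    using I_l_closed[OF that, of p] by simp
  show "a * p \<in> qweyl_ideal q" if "a \<in> qweyl_ideal q" for a
    using I_r_closed[OF that, of p] by simp
  show minus: "- a \<in> qweyl_ideal q" if "a \<in> qweyl_ideal q" for a
    using l[OF that, of "- 1"] by simp
  show "a - b \<in> qweyl_ideal q" if "a \<in> qweyl_ideal q" "b \<in> qweyl_ideal q"
    using add[OF that(1) minus[OF that(2)]] by simp
qed

lemma qweyl_coset_eq_iff:
  "qweyl_ideal q +>\<^bsub>free_algebra\<^esub> a = qweyl_ideal q +>\<^bsub>free_algebra\<^esub> b \<longleftrightarrow> a - b \<in> qweyl_ideal q"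
proof
  assume "qweyl_ideal q +>\<^bsub>free_algebra\<^esub> a = qweyl_ideal q +>\<^bsub>free_algebra\<^esub> b"
  then show "a - b \<in> qweyl_ideal q"
    using qweyl_coset_mem_iff[of a q a] qweyl_coset_mem_iff[of a q b]
    by (simp add: qweyl_ideal_closed)
next
  assume *: "a - b \<in> qweyl_ideal q"
  have "x - a \<in> qweyl_ideal q \<longleftrightarrow> x - b \<in> qweyl_ideal q" for x
    using qweyl_ideal_closed(2)[OF _ *, of "x - a"] qweyl_ideal_closed(6)[OF _ *, of "x - b"]
    by auto
  then show "qweyl_ideal q +>\<^bsub>free_algebra\<^esub> a = qweyl_ideal q +>\<^bsub>free_algebra\<^esub> b"
    by (auto simp: qweyl_coset_mem_iff)
qed

lemma qweyl_smult:
  "c \<odot>\<^bsub>qweyl q\<^esub> (qweyl_ideal q +>\<^bsub>free_algebra\<^esub> a) = qweyl_ideal q +>\<^bsub>free_algebra\<^esub> (const c * a)"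
proof -
  have "qweyl_ideal q +>\<^bsub>free_algebra\<^esub> (const c * b) = qweyl_ideal q +>\<^bsub>free_algebra\<^esub> (const c * a)"
    if "b \<in> qweyl_ideal q +>\<^bsub>free_algebra\<^esub> a" for b
    using that qweyl_ideal_closed(3)[of "b - a" q "const c"]
    by (simp add: qweyl_coset_mem_iff qweyl_coset_eq_iff right_diff_distrib)
  moreover have "a \<in> qweyl_ideal q +>\<^bsub>free_algebra\<^esub> a"
    by (simp add: qweyl_coset_mem_iff qweyl_ideal_closed)
  moreover have "c \<odot>\<^bsub>qweyl q\<^esub> C = (\<Union>b\<in>C. qweyl_ideal q +>\<^bsub>free_algebra\<^esub> (const c * b))" for C
    by (simp add: qweyl_def quotient_algebra_def ring.defs module.defs)
  ultimately show ?thesis by blast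
qed

lemma ring_qweyl: "ring (qweyl q)"
proof (rule ringI)
  show "abelian_group (qweyl q)"
  proof (rule abelian_groupI)
    fix x assume "x \<in> carrier (qweyl q)"
    then obtain p where p: "x = qweyl_ideal q +>\<^bsub>free_algebra\<^esub> p" by (auto simp: carrier_qweyl)
    show "\<exists>y\<in>carrier (qweyl q). y \<oplus>\<^bsub>qweyl q\<^esub> x = \<zero>\<^bsub>qweyl q\<^esub>"
      by (rule bexI[of _ "qweyl_ideal q +>\<^bsub>free_algebra\<^esub> (- p)"])
        (simp_all add: p qweyl_add qweyl_zero carrier_qweyl)
  qed (auto simp: carrier_qweyl qweyl_add qweyl_zero algebra_simps)
  show "Group.monoid (qweyl q)"
    by (rule monoidI) (auto simp: carrier_qweyl qweyl_mult qweyl_one algebra_simps)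
qed (auto simp: carrier_qweyl qweyl_mult qweyl_add algebra_simps)

lemma module_qweyl: "module (ring_of_type_algebra :: 'k::field ring) (qweyl (q :: 'k))"
proof (rule moduleI)
  show "cring (ring_of_type_algebra :: 'k ring)" ..
  show "abelian_group (qweyl q)"
    using ring_qweyl[of q] by (rule ring.is_abelian_group)
qed (auto simp: carrier_qweyl qweyl_add qweyl_smult ring_of_type_algebra_def
       const_mult const_add const_one algebra_simps)

lemma qweyl_smult_mult:
  assumes "a \<in> carrier (qweyl q)" "b \<in> carrier (qweyl q)"
  shows "(c \<odot>\<^bsub>qweyl q\<^esub> a) \<otimes>\<^bsub>qweyl q\<^esub> b = c \<odot>\<^bsub>qweyl q\<^esub> (a \<otimes>\<^bsub>qweyl q\<^esub> b)"
    and "a \<otimes>\<^bsub>qweyl q\<^esub> (c \<odot>\<^bsub>qweyl q\<^esub> b) = c \<odot>\<^bsub>qweyl q\<^esub> (a \<otimes>\<^bsub>qweyl q\<^esub> b)"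
proof -
  have "x * (const c * y) = const c * (x * y)" for x y :: "(generator, 'a) free_alg"
    by (metis const_commute mult.assoc)
  with assms show "(c \<odot>\<^bsub>qweyl q\<^esub> a) \<otimes>\<^bsub>qweyl q\<^esub> b = c \<odot>\<^bsub>qweyl q\<^esub> (a \<otimes>\<^bsub>qweyl q\<^esub> b)"
    and "a \<otimes>\<^bsub>qweyl q\<^esub> (c \<odot>\<^bsub>qweyl q\<^esub> b) = c \<odot>\<^bsub>qweyl q\<^esub> (a \<otimes>\<^bsub>qweyl q\<^esub> b)"
    by (auto simp: carrier_qweyl qweyl_mult qweyl_smult mult.assoc)
qed

lemma qweyl_uminus:
  "\<ominus>\<^bsub>qweyl q\<^esub> (qweyl_ideal q +>\<^bsub>free_algebra\<^esub> p) = qweyl_ideal q +>\<^bsub>free_algebra\<^esub> (- p)"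
proof -
  interpret ring "qweyl q" by (rule ring_qweyl)
  show ?thesis
    by (rule minus_equality) (auto simp: qweyl_add qweyl_zero carrier_qweyl)
qed

lemma qweyl_relation:
  "qweyl_X q \<in> carrier (qweyl q)" "qweyl_Y q \<in> carrier (qweyl q)"
  "qweyl_Y q \<otimes>\<^bsub>qweyl q\<^esub> qweyl_X q \<ominus>\<^bsub>qweyl q\<^esub> (q \<odot>\<^bsub>qweyl q\<^esub> (qweyl_X q \<otimes>\<^bsub>qweyl q\<^esub> qweyl_Y q))
     = \<one>\<^bsub>qweyl q\<^esub>"
proof -
  have "var GenY * var GenX - const q * var GenX * var GenY - 1 \<in> qweyl_ideal q"
    unfolding qweyl_ideal_def by (rule ring.genideal_self'[OF ring_free_algebra]) simp
  then show "qweyl_Y q \<otimes>\<^bsub>qweyl q\<^esub> qweyl_X q \<ominus>\<^bsub>qweyl q\<^esub>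
      (q \<odot>\<^bsub>qweyl q\<^esub> (qweyl_X q \<otimes>\<^bsub>qweyl q\<^esub> qweyl_Y q)) = \<one>\<^bsub>qweyl q\<^esub>"
    by (simp add: qweyl_X_def qweyl_Y_def qweyl_mult qweyl_smult a_minus_def qweyl_uminus
        qweyl_add qweyl_one qweyl_coset_eq_iff mult.assoc)
qed (auto simp: qweyl_X_def qweyl_Y_def carrier_qweyl)

lemma derivation_qweyl_unique:
  assumes D: "D \<in> derivations (qweyl q)" and E: "E \<in> derivations (qweyl q)"
    and X: "D (qweyl_X q) = E (qweyl_X q)" and Y: "D (qweyl_Y q) = E (qweyl_Y q)"
  shows "D = E"
proof -
  interpret ring "qweyl q" by (rule ring_qweyl)
  define Q where "Q = (\<lambda>p. qweyl_ideal q +>\<^bsub>free_algebra\<^esub> p)"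
  have Qc: "Q p \<in> carrier (qweyl q)" for p by (auto simp: Q_def carrier_qweyl)
  have one: "F \<one>\<^bsub>qweyl q\<^esub> = \<zero>\<^bsub>qweyl q\<^esub>" if F: "F \<in> derivations (qweyl q)" for F
  proof -
    have c: "F \<one>\<^bsub>qweyl q\<^esub> \<in> carrier (qweyl q)" using F by (auto simp: derivations_def)
    have "F (\<one>\<^bsub>qweyl q\<^esub> \<otimes>\<^bsub>qweyl q\<^esub> \<one>\<^bsub>qweyl q\<^esub>) =
        F \<one>\<^bsub>qweyl q\<^esub> \<otimes>\<^bsub>qweyl q\<^esub> \<one>\<^bsub>qweyl q\<^esub> \<oplus>\<^bsub>qweyl q\<^esub> \<one>\<^bsub>qweyl q\<^esub> \<otimes>\<^bsub>qweyl q\<^esub> F \<one>\<^bsub>qweyl q\<^esub>"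
      using F one_closed unfolding derivations_def by blast
    then have "F \<one>\<^bsub>qweyl q\<^esub> = F \<one>\<^bsub>qweyl q\<^esub> \<oplus>\<^bsub>qweyl q\<^esub> F \<one>\<^bsub>qweyl q\<^esub>" using c by simp
    then show ?thesis using c by (metis r_zero add.l_cancel zero_closed)
  qed
  have var: "D (Q (var g)) = E (Q (var g))" for g
    using X Y by (cases g) (simp_all add: Q_def qweyl_X_def qweyl_Y_def)
  have word: "D (Q (Poly_Mapping.single (Word u) 1)) = E (Q (Poly_Mapping.single (Word u) 1))" for u
  proof (induction u)
    case Nil
    have "Q (Poly_Mapping.single (Word []) 1) = \<one>\<^bsub>qweyl q\<^esub>"
      by (simp add: Q_def qweyl_one flip: zero_free_monoid_def)
    then show ?case using one[OF D] one[OF E] by simp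
  next
    case (Cons g u)
    have m: "Q (Poly_Mapping.single (Word (g # u)) 1) =
        Q (var g) \<otimes>\<^bsub>qweyl q\<^esub> Q (Poly_Mapping.single (Word u) 1)"
      by (simp add: Q_def qweyl_mult single_Word_Cons)
    show ?case using D E Cons var[of g] Qc unfolding m derivations_def by simp
  qed
  have all: "D (Q p) = E (Q p)" for p
  proof (induction p rule: free_alg_induct)
    case (single w c)
    have m: "Q (Poly_Mapping.single w c) = c \<odot>\<^bsub>qweyl q\<^esub> Q (Poly_Mapping.single (Word (letters w)) 1)"
      by (simp add: Q_def qweyl_smult const_def mult_single)
    show ?case using D E word[of "letters w"] Qc unfolding m derivations_def by simp
  next
    case (add p r)
    have m: "Q (p + r) = Q p \<oplus>\<^bsub>qweyl q\<^esub> Q r" by (simp add: Q_def qweyl_add)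
    show ?case using D E add Qc unfolding m derivations_def by simp
  qed
  show ?thesis
  proof (rule PiE_ext)
    show "D \<in> carrier (qweyl q) \<rightarrow>\<^sub>E carrier (qweyl q)" "E \<in> carrier (qweyl q) \<rightarrow>\<^sub>E carrier (qweyl q)"
      using D E by (auto simp: derivations_def)
    show "D x = E x" if "x \<in> carrier (qweyl q)" for x
      using that all by (auto simp: carrier_qweyl Q_def)
  qed
qed

definition word_weight :: "generator free_monoid \<Rightarrow> 'k::field" where
  "word_weight w = of_nat (count_list (letters w) GenX) - of_nat (count_list (letters w) GenY)"

definition free_H :: "(generator, 'k::field) free_alg \<Rightarrow> (generator, 'k) free_alg" where
  "free_H p = Poly_Mapping.mapp (\<lambda>w c. word_weight w * c) p"

lemma lookup_free_H: "Poly_Mapping.lookup (free_H p) w = word_weight w * Poly_Mapping.lookup p w"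
  by (cases "w \<in> Poly_Mapping.keys p") (simp_all add: free_H_def mapp.rep_eq in_keys_iff)

lemma free_H_add: "free_H (p + r) = free_H p + free_H r"
  by (intro poly_mapping_eqI) (simp add: lookup_free_H lookup_add algebra_simps)

lemma free_H_diff: "free_H (p - r) = free_H p - free_H r"
  by (intro poly_mapping_eqI) (simp add: lookup_free_H lookup_minus algebra_simps)

lemma free_H_single: "free_H (Poly_Mapping.single w c) = Poly_Mapping.single w (word_weight w * c)"
  by (intro poly_mapping_eqI) (simp add: lookup_free_H lookup_single when_def)

lemma word_weight_add: "word_weight (u + v) = word_weight u + word_weight v"
  by (simp add: word_weight_def plus_free_monoid_def)

lemma free_H_mult: "free_H (p * r) = free_H p * r + p * free_H r"
proof (induction p rule: free_alg_induct)
  case (single u c)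
  show ?case
  proof (induction r rule: free_alg_induct)
    case (single v d)
    show ?case
      by (simp add: mult_single free_H_single word_weight_add algebra_simps flip: single_add)
  next
    case (add r s)
    then show ?case by (simp add: distrib_left free_H_add)
  qed
next
  case (add p s)
  then show ?case by (simp add: distrib_right free_H_add)
qed

lemma free_H_const: "free_H (const c) = 0"
  by (simp add: const_def free_H_single word_weight_def zero_free_monoid_def)

lemma free_H_var: "free_H (var GenX) = var GenX" "free_H (var GenY) = - var GenY"
  by (simp_all add: var_def free_H_single word_weight_def single_uminus)

lemma free_H_ideal:
  assumes "p \<in> qweyl_ideal q" shows "free_H p \<in> qweyl_ideal q"
proof -
  let ?F = "free_algebra :: ('a, (generator, 'a) free_alg) module"
  let ?r = "var GenY * var GenX - const q * var GenX * var GenY - 1"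
  interpret ring ?F by (rule ring_free_algebra)
  define J where "J = {p \<in> qweyl_ideal q. free_H p \<in> qweyl_ideal q}"
  have inv: "\<ominus>\<^bsub>?F\<^esub> x = - x" for x by (rule minus_equality) simp_all
  have zero: "free_H 0 = (0 :: (generator, 'a) free_alg)"
    using free_H_const[of "0::'a"] by (simp add: const_def)
  have free_H_minus: "free_H (- x) = - free_H x" for x :: "(generator, 'a) free_alg"
    using free_H_diff[of 0 x] zero by simp
  have "ideal J ?F"
  proof (rule idealI)
    show "subgroup J (add_monoid ?F)"
    proof (rule add.subgroupI)
      show "J \<noteq> {}" using zero qweyl_ideal_closed(1)[of q] by (auto simp: J_def)
      show "\<ominus>\<^bsub>?F\<^esub> a \<in> J" if "a \<in> J" for a
        using that inv[of a] by (simp add: J_def free_H_minus qweyl_ideal_closed)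
    qed (auto simp: J_def free_H_add qweyl_ideal_closed)
  qed (auto simp: J_def free_H_mult qweyl_ideal_closed ring_free_algebra)
  moreover have "?r \<in> J"
  proof -
    have 1: "free_H (1 :: (generator, 'a) free_alg) = 0"
      using free_H_const[of "1::'a"] by (simp add: const_one)
    have "free_H ?r = 0"
      by (simp add: free_H_diff free_H_mult free_H_const free_H_var 1)
    moreover have "?r \<in> qweyl_ideal q"
      unfolding qweyl_ideal_def by (rule genideal_self') simp
    ultimately show ?thesis by (simp add: J_def qweyl_ideal_closed)
  qed
  ultimately have "qweyl_ideal q \<subseteq> J"
    unfolding qweyl_ideal_def by (intro genideal_minimal) auto
  then show ?thesis using assms by (auto simp: J_def)
qed

lemma qweyl_H_ex1:
  "\<exists>!D. D \<in> derivations (qweyl q) \<and>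
     D (qweyl_X q) = qweyl_X q \<and> D (qweyl_Y q) = \<ominus>\<^bsub>qweyl q\<^esub> qweyl_Y q"
proof (rule ex_ex1I)
  define Q where "Q = (\<lambda>p. qweyl_ideal q +>\<^bsub>free_algebra\<^esub> p)"
  define h where "h = (\<lambda>C\<in>carrier (qweyl q). Q (free_H (SOME p. C = Q p)))"
  have Qc: "carrier (qweyl q) = range Q" by (auto simp: Q_def carrier_qweyl)
  have h: "h (Q p) = Q (free_H p)" for p
  proof -
    define r where "r = (SOME r. Q p = Q r)"
    have "Q p = Q r" unfolding r_def by (rule someI[of _ p]) simp
    then have "free_H (r - p) \<in> qweyl_ideal q"
      by (metis Q_def qweyl_coset_eq_iff free_H_ideal)
    then have "Q (free_H r) = Q (free_H p)"
      by (simp add: Q_def qweyl_coset_eq_iff free_H_diff)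
    then show ?thesis by (simp add: h_def Qc r_def)
  qed
  have "h \<in> derivations (qweyl q)"
    unfolding derivations_def
  proof (intro CollectI conjI)
    show "h \<in> carrier (qweyl q) \<rightarrow>\<^sub>E carrier (qweyl q)"
      by (auto simp: h_def Qc)
  qed (auto simp: Qc h Q_def[symmetric] qweyl_add[of q, folded Q_def]
        qweyl_mult[of q, folded Q_def] qweyl_smult[of q, folded Q_def] free_H_add free_H_mult
        free_H_const)
  moreover have "h (qweyl_X q) = qweyl_X q" "h (qweyl_Y q) = \<ominus>\<^bsub>qweyl q\<^esub> qweyl_Y q"
    using h[of "var GenX"] h[of "var GenY"]
    by (simp_all add: qweyl_X_def qweyl_Y_def Q_def free_H_var qweyl_uminus)
  ultimately show "\<exists>D. D \<in> derivations (qweyl q) \<and>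
     D (qweyl_X q) = qweyl_X q \<and> D (qweyl_Y q) = \<ominus>\<^bsub>qweyl q\<^esub> qweyl_Y q" by blast
qed (auto intro: derivation_qweyl_unique)

end

theory Submission
  imports Defs
begin

text \<open>
  Put \<open>Z = YX - XY = 1 + (q - 1) XY\<close>. Then \<open>ZX = qXZ\<close> and \<open>YZ = qZY\<close>, and the algebra embeds
  into the ring of twisted Laurent polynomials \<open>\<Sum>\<^sub>n P\<^sub>n(Z) X\<^sup>n\<close> with \<open>X P(Z) = P(Z/q) X\<close>, where
  \<open>Y = (qZ - 1)/(q - 1) X\<^sup>-\<^sup>1\<close>. The family of coefficients \<open>P\<^sub>n\<close> is called the symbol below. Symbols
  are defined on the free algebra, and an element has zero symbol exactly if it lies in the ideal
  of the relation (\<open>symbol_eq_zero_iff\<close>). A derivation of the quotient is therefore studied through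
  a lift \<open>d\<close> to the free algebra, equality in the quotient being equality of symbols. Symbols of top
  weight multiply without cancellation (\<open>symbol_top_mult\<close>), since \<open>k[Z]\<close> is a domain. This is
  so for roots of unity, too, and the argument is uniform in \<open>q\<close>.

  Let \<open>D\<close> be locally finite. Give \<open>X\<close> the weight 1 and \<open>Y\<close> the weight -1, or the opposite signs, and
  suppose that \<open>D\<close> raises the weight by at most \<open>M \<ge> 1\<close>, with \<open>M\<close> attained on \<open>X\<close> or \<open>Y\<close>. For an
  element of weight at most \<open>i\<close>, the part of \<open>D\<^sup>n a\<close> of weight \<open>i + nM\<close> vanishes for large \<open>n\<close>, because
  the weights in the orbit of \<open>a\<close> are bounded. Call the last \<open>n\<close> for which it does not vanish the order
  of \<open>a\<close>. By the Leibniz rule in characteristic zero the order is additive on products. Modulo \<open>Z\<close> the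
  algebra is commutative, so \<open>D(Z) = Zb\<close> for some \<open>b\<close>. If \<open>Z\<close> had positive order, the order of \<open>D(Z)\<close>
  would be one less than that of \<open>Z\<close> and also at least that of \<open>Z\<close>. So \<open>Z\<close> has order zero, and so has
  \<open>XY\<close>, which is a linear polynomial in \<open>Z\<close>. By additivity \<open>X\<close> and \<open>Y\<close> have order zero, contrary to the
  choice of \<open>M\<close> (\<open>no_positive_part\<close>).

  Hence \<open>D\<close> preserves weights: \<open>D(X) = f(Z) X\<close> and \<open>D(R(Z)) = R'(Z) S(Z)\<close> for a polynomial \<open>S\<close>.
  As \<open>Z\<close> divides \<open>D(Z)\<close>, \<open>S(0) = 0\<close>. As every element of weight -1 is a multiple of \<open>Y\<close>, \<open>Z - 1\<close>
  divides \<open>D(XY)\<close>, so \<open>S(1) = 0\<close>. If \<open>S\<close> had degree at least 2, the degrees of \<open>D\<^sup>n(Z)\<close> would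
  grow without bound. So \<open>S = 0\<close>, which means \<open>D(Z) = 0\<close>. Then \<open>D\<^sup>n(X) = f(Z)\<^sup>n X\<close>
  forces \<open>f\<close> to be a constant \<open>c\<close>, and \<open>D(Z) = 0\<close> forces \<open>D(Y) = -cY\<close> (\<open>scalar_on_generators\<close>).

  Conversely, every word in \<open>X\<close> and \<open>Y\<close> is an eigenvector of \<open>H\<close>. A locally nilpotent derivation is
  locally finite, so it is some \<open>cH\<close>, and \<open>(cH)\<^sup>n(X) = c\<^sup>n X\<close> gives \<open>c = 0\<close>.
\<close>


section \<open>Derivations of a free algebra\<close>

lemma free_alg_left_induct [case_names const add var]:
  fixes p :: "('g, 'k::field) free_alg"
  assumes const: "\<And>c. P (const c)"
    and add: "\<And>p r. P p \<Longrightarrow> P r \<Longrightarrow> P (p + r)"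
    and var: "\<And>g p. P p \<Longrightarrow> P (var g * p)"
  shows "P p"
proof (induction p rule: free_alg_induct)
  case (single w c)
  have "P (Poly_Mapping.single (Word u) c)" for u
  proof (induction u)
    case Nil
    show ?case using const[of c] by (simp add: const_def zero_free_monoid_def)
  next
    case (Cons g u)
    then show ?case using var by (simp add: single_Word_Cons)
  qed
  then show ?case by (metis free_monoid.collapse)
qed (rule add)

locale free_alg_derivation =
  fixes d :: "('g, 'k::field) free_alg \<Rightarrow> ('g, 'k) free_alg"
  assumes add: "d (p + r) = d p + d r"
    and const: "d (const c) = 0"
    and mult: "d (p * r) = d p * r + p * d r"
begin

lemma zero: "d 0 = 0"
  using const[of 0] by (simp add: const_def)

lemma one: "d 1 = 0"
  using const[of 1] by (simp add: const_one)

lemma const_mult: "d (const c * p) = const c * d p"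
  by (simp add: mult const)

lemma uminus: "d (- p) = - d p"
  using add[of p "- p"] by (simp add: zero add_eq_0_iff)

lemma diff: "d (p - r) = d p - d r"
  using add[of p "- r"] by (simp add: uminus)

lemma sum: "d (sum f W) = (\<Sum>i\<in>W. d (f i))"
  by (induction W rule: infinite_finite_induct) (simp_all add: zero add)

lemma of_nat_mult: "d (of_nat n * p) = of_nat n * d p"
  by (induction n) (simp_all add: zero add distrib_right)

lemma iterate_const_mult: "(d ^^ n) (const c * p) = const c * (d ^^ n) p"
  by (induction n) (simp_all add: const_mult)

lemma iterate_diff: "(d ^^ n) (p - r) = (d ^^ n) p - (d ^^ n) r"
  by (induction n) (simp_all add: diff)

lemma leibniz:
  "(d ^^ n) (p * r) = (\<Sum>k\<le>n. of_nat (n choose k) * ((d ^^ k) p * (d ^^ (n - k)) r))"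
proof (induction n)
  case (Suc n)
  let ?t = "\<lambda>k l. (d ^^ k) p * (d ^^ l) r"
  have "(d ^^ Suc n) (p * r) =
      (\<Sum>k\<le>n. of_nat (n choose k) * ?t (Suc k) (n - k)) +
      (\<Sum>k\<le>n. of_nat (n choose k) * ?t k (Suc (n - k)))"
    by (simp add: Suc sum of_nat_mult) (simp add: mult distrib_left sum.distrib)
  also have "(\<Sum>k\<le>n. of_nat (n choose k) * ?t k (Suc (n - k))) =
      (\<Sum>k\<le>n. of_nat (n choose k) * ?t k (Suc n - k))"
    by (rule sum.cong) (auto simp: Suc_diff_le)
  also have "\<dots> = (\<Sum>k\<le>Suc n. of_nat (n choose k) * ?t k (Suc n - k))"
    by (simp add: binomial_eq_0)
  also have "\<dots> = ?t 0 (Suc n) + (\<Sum>k\<le>n. of_nat (n choose Suc k) * ?t (Suc k) (n - k))"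
    by (subst sum.atMost_Suc_shift) (simp add: binomial_eq_0)
  also have "(\<Sum>k\<le>n. of_nat (n choose k) * ?t (Suc k) (n - k)) +
      (?t 0 (Suc n) + (\<Sum>k\<le>n. of_nat (n choose Suc k) * ?t (Suc k) (n - k))) =
      ?t 0 (Suc n) + (\<Sum>k\<le>n. of_nat (Suc n choose Suc k) * ?t (Suc k) (n - k))"
    by (simp add: sum.distrib distrib_right add_ac)
  also have "\<dots> = (\<Sum>k\<le>Suc n. of_nat (Suc n choose k) * ?t k (Suc n - k))"
    by (subst sum.atMost_Suc_shift) simp
  finally show ?case .
qed simp

end

text \<open>
  A derivation of a free algebra may take arbitrary values \<open>v\<close> on the generators. The Leibniz rule
  then dictates its value on words, and linearity its value on all elements.
\<close>

primrec word_derivation ::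
    "('g \<Rightarrow> ('g, 'k::field) free_alg) \<Rightarrow> 'g list \<Rightarrow> ('g, 'k) free_alg" where
  "word_derivation v [] = 0"
| "word_derivation v (g # u) =
     v g * Poly_Mapping.single (Word u) 1 + var g * word_derivation v u"

definition free_derivation ::
    "('g \<Rightarrow> ('g, 'k::field) free_alg) \<Rightarrow> ('g, 'k) free_alg \<Rightarrow> ('g, 'k) free_alg" where
  "free_derivation v p =
     (\<Sum>w\<in>Poly_Mapping.keys p. const (Poly_Mapping.lookup p w) * word_derivation v (letters w))"

lemma free_derivation_add: "free_derivation v (p + r) = free_derivation v p + free_derivation v r"
  unfolding free_derivation_def
  by (rule setsum_keys_plus_distrib[of "\<lambda>w c. const c * word_derivation v (letters w)"])
    (simp_all add: const_def single_add distrib_right)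

lemma free_derivation_single:
  "free_derivation v (Poly_Mapping.single w c) = const c * word_derivation v (letters w)"
  by (simp add: free_derivation_def const_def)

lemma free_derivation_const: "free_derivation v (const c) = 0"
  by (simp add: const_def[of c] free_derivation_single zero_free_monoid_def)

lemma free_derivation_const_mult: "free_derivation v (const c * p) = const c * free_derivation v p"
proof (induction p rule: free_alg_induct)
  case (single w e)
  have "const c * Poly_Mapping.single w e = Poly_Mapping.single w (c * e)"
    by (simp add: const_def mult_single)
  then show ?case by (simp add: free_derivation_single const_mult mult.assoc)
qed (simp add: distrib_left free_derivation_add)

lemma free_derivation_var_mult:
  "free_derivation v (var g * p) = v g * p + var g * free_derivation v p"
proof (induction p rule: free_alg_induct)
  case (single w c)
  obtain u where w: "w = Word u" by (cases w)
  have c: "Poly_Mapping.single (Word u) c = const c * Poly_Mapping.single (Word u) 1"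
    by (simp add: const_def mult_single)
  have comm: "x * (const c * y) = const c * (x * y)" for x y :: "('a, 'b) free_alg"
    by (metis const_commute mult.assoc)
  show ?case unfolding w
    by (subst single_Word_Cons[symmetric])
      (simp add: free_derivation_single free_derivation_const_mult c comm distrib_left const_one)
qed (simp add: distrib_left free_derivation_add)

lemma free_derivation_var: "free_derivation v (var g) = v g"
  using free_derivation_var_mult[of v g "const 1"] free_derivation_const[of v 1] by (simp add: const_one)

lemma free_alg_derivation_free_derivation: "free_alg_derivation (free_derivation v)"
proof
  show "free_derivation v (p * r) = free_derivation v p * r + p * free_derivation v r" for p r
  proof (induction p rule: free_alg_left_induct)
    case (const c)
    then show ?case by (simp add: free_derivation_const_mult free_derivation_const)
  next
    case (add p s)
    then show ?case by (simp add: distrib_right free_derivation_add)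
  next
    case (var g p)
    then show ?case by (simp add: mult.assoc free_derivation_var_mult algebra_simps)
  qed
qed (simp_all add: free_derivation_add free_derivation_const)

section \<open>Derivations of the quotient algebra and their lifts\<close>

abbreviation qweyl_class :: "'k::field \<Rightarrow> (generator, 'k) free_alg \<Rightarrow> (generator, 'k) free_alg set" where
  "qweyl_class q p \<equiv> qweyl_ideal q +>\<^bsub>free_algebra\<^esub> p"

lemma qweyl_class_carrier: "qweyl_class q p \<in> carrier (qweyl q)"
  by (auto simp: carrier_qweyl)

lemma derivation_qweyl_carrier:
  "D \<in> derivations (qweyl q) \<Longrightarrow> D (qweyl_class q p) \<in> carrier (qweyl q)"
  using qweyl_class_carrier by (auto simp: derivations_def)

lemma derivation_qweyl_add:
  "D \<in> derivations (qweyl q) \<Longrightarrow>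
    D (qweyl_class q (p + r)) = D (qweyl_class q p) \<oplus>\<^bsub>qweyl q\<^esub> D (qweyl_class q r)"
  using qweyl_class_carrier[of q p] qweyl_class_carrier[of q r]
  by (simp add: derivations_def flip: qweyl_add)

lemma derivation_qweyl_mult:
  "D \<in> derivations (qweyl q) \<Longrightarrow>
    D (qweyl_class q (p * r)) = D (qweyl_class q p) \<otimes>\<^bsub>qweyl q\<^esub> qweyl_class q r
      \<oplus>\<^bsub>qweyl q\<^esub> qweyl_class q p \<otimes>\<^bsub>qweyl q\<^esub> D (qweyl_class q r)"
  using qweyl_class_carrier[of q p] qweyl_class_carrier[of q r]
  by (simp add: derivations_def flip: qweyl_mult)

lemma derivation_qweyl_const:
  assumes D: "D \<in> derivations (qweyl q)"
  shows "D (qweyl_class q (const c)) = qweyl_class q 0"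
proof -
  obtain r where r: "D (qweyl_class q 1) = qweyl_class q r"
    using derivation_qweyl_carrier[OF D, of 1] by (auto simp: carrier_qweyl)
  have "D (qweyl_class q 1) = qweyl_class q (r + r)"
    using derivation_qweyl_mult[OF D, of 1 1] by (simp add: r qweyl_mult qweyl_add)
  then have "qweyl_class q (r + r) = qweyl_class q r"
    by (simp add: r)
  then have "r \<in> qweyl_ideal q"
    by (simp add: qweyl_coset_eq_iff)
  then have "qweyl_class q r = qweyl_class q 0"
    by (simp add: qweyl_coset_eq_iff)
  moreover have "D (c \<odot>\<^bsub>qweyl q\<^esub> qweyl_class q 1) = c \<odot>\<^bsub>qweyl q\<^esub> D (qweyl_class q 1)"
    using D qweyl_class_carrier[of q 1] by (simp add: derivations_def)
  ultimately show ?thesis by (simp add: r qweyl_smult)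
qed

text \<open>
  Both sides satisfy the same sum, scalar and product rules, so agreement on generators suffices.
  Iterates of \<open>D\<close> can thus be computed with \<open>d\<close>, for which Leibniz' formula has no carrier conditions.
\<close>

lemma derivation_qweyl_lift:
  assumes D: "D \<in> derivations (qweyl q)" and d: "free_alg_derivation d"
    and gen: "\<And>g. D (qweyl_class q (var g)) = qweyl_class q (d (var g))"
  shows "D (qweyl_class q p) = qweyl_class q (d p)"
proof -
  interpret free_alg_derivation d by (rule d)
  show ?thesis
    by (induction p rule: free_alg_left_induct)
      (simp_all add: derivation_qweyl_const[OF D] const derivation_qweyl_add[OF D] add qweyl_add
        derivation_qweyl_mult[OF D] mult qweyl_mult gen)
qed

lemma iterate_qweyl_lift:
  assumes "\<And>p. D (qweyl_class q p) = qweyl_class q (d p)"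
  shows "(D ^^ n) (qweyl_class q p) = qweyl_class q ((d ^^ n) p)"
  by (induction n) (simp_all add: assms)

section \<open>Coefficients in twisted Laurent polynomials\<close>

text \<open>
  The substitution \<open>p(Z) \<mapsto> p(cZ)\<close>. Moving a polynomial in \<open>Z\<close> past a power of \<open>X\<close> amounts to such
  a substitution.
\<close>

definition rescale :: "'k::field \<Rightarrow> 'k poly \<Rightarrow> 'k poly" where
  "rescale c p = pcompose p [:0, c:]"

lemma rescale_0 [simp]: "rescale c 0 = 0"
  and rescale_1 [simp]: "rescale c 1 = 1"
  and rescale_by_1 [simp]: "rescale 1 p = p"
  and rescale_pCons: "rescale c (pCons a p) = pCons a (smult c (rescale c p))"
  and rescale_add: "rescale c (p + r) = rescale c p + rescale c r"
  and rescale_mult: "rescale c (p * r) = rescale c p * rescale c r"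
  and rescale_smult: "rescale c (smult a p) = smult a (rescale c p)"
  and rescale_rescale: "rescale c (rescale e p) = rescale (c * e) p"
  and rescale_sum: "rescale c (sum f W) = (\<Sum>i\<in>W. rescale c (f i))"
  and poly_rescale: "poly (rescale c p) x = poly p (c * x)"
  by (simp_all add: rescale_def pcompose_1 pcompose_pCons pcompose_add pcompose_mult
      pcompose_smult pcompose_sum poly_pcompose mult.commute flip: pcompose_assoc)

lemma rescale_eq_0_iff [simp]: "c \<noteq> 0 \<Longrightarrow> rescale c p = 0 \<longleftrightarrow> p = 0"
  and degree_rescale [simp]: "c \<noteq> 0 \<Longrightarrow> Polynomial.degree (rescale c p) = Polynomial.degree p"
proof -
  assume c: "c \<noteq> 0"
  have "p = rescale (inverse c) (rescale c p)" using c by (simp add: rescale_rescale)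
  then show "rescale c p = 0 \<longleftrightarrow> p = 0" by auto
  show "Polynomial.degree (rescale c p) = Polynomial.degree p"
    using c by (simp add: rescale_def degree_pcompose)
qed

locale quantum_weyl =
  fixes q :: "'k::field_char_0"
  assumes q_nonzero: "q \<noteq> 0" and q_not_one: "q \<noteq> 1"
begin

text \<open>
  A function \<open>f\<close> stands for \<open>\<Sum>\<^sub>n f(n)(Z) X\<^sup>n\<close>, and \<open>X\<close> and \<open>Y = (qZ - 1)/(q - 1) X\<^sup>-\<^sup>1\<close> act by left
  multiplication, subject to \<open>X P(Z) = P(Z/q) X\<close>.
\<close>

fun generator_act :: "generator \<Rightarrow> (int \<Rightarrow> 'k poly) \<Rightarrow> int \<Rightarrow> 'k poly" where
  "generator_act GenX f m = rescale (inverse q) (f (m - 1))"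
| "generator_act GenY f m = smult (inverse (q - 1)) [:- 1, q:] * rescale q (f (m + 1))"

definition unit_symbol :: "int \<Rightarrow> 'k poly" where
  "unit_symbol m = (if m = 0 then 1 else 0)"

definition word_symbol :: "generator free_monoid \<Rightarrow> int \<Rightarrow> 'k poly" where
  "word_symbol w = foldr generator_act (letters w) unit_symbol"

definition symbol :: "(generator, 'k) free_alg \<Rightarrow> int \<Rightarrow> 'k poly" where
  "symbol p m =
     (\<Sum>w\<in>Poly_Mapping.keys p. smult (Poly_Mapping.lookup p w) (word_symbol w m))"

lemma symbol_add: "symbol (p + r) m = symbol p m + symbol r m"
  unfolding symbol_def
  by (rule setsum_keys_plus_distrib[of "\<lambda>w c. smult c (word_symbol w m)"])
    (simp_all add: smult_add_left)

lemma symbol_single: "symbol (Poly_Mapping.single w c) m = smult c (word_symbol w m)"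
  by (simp add: symbol_def)

lemma symbol_zero: "symbol 0 m = 0"
  by (simp add: symbol_def)

lemma symbol_uminus: "symbol (- p) m = - symbol p m"
  using symbol_add[of p "- p" m] by (simp add: symbol_zero add_eq_0_iff)

lemma symbol_diff: "symbol (p - r) m = symbol p m - symbol r m"
  using symbol_add[of p "- r" m] by (simp add: symbol_uminus)

lemma symbol_sum: "symbol (sum f W) m = (\<Sum>i\<in>W. symbol (f i) m)"
  by (induction W rule: infinite_finite_induct) (simp_all add: symbol_zero symbol_add)

lemma symbol_of_nat_mult: "symbol (of_nat n * p) m = of_nat n * symbol p m"
  by (induction n) (simp_all add: symbol_zero symbol_add distrib_right)

lemma symbol_const: "symbol (const c) m = (if m = 0 then [:c:] else 0)"
  by (simp add: const_def symbol_single word_symbol_def zero_free_monoid_def unit_symbol_def)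

lemma symbol_one: "symbol 1 m = (if m = 0 then 1 else 0)"
  using symbol_const[of 1 m] by (simp add: const_one one_pCons)

lemma symbol_const_mult: "symbol (const c * p) m = smult c (symbol p m)"
proof (induction p rule: free_alg_induct)
  case (single w e)
  have "const c * Poly_Mapping.single w e = Poly_Mapping.single w (c * e)"
    by (simp add: const_def mult_single)
  then show ?case by (simp add: symbol_single)
qed (simp add: distrib_left symbol_add smult_add_right)

lemma generator_act_add:
  "generator_act g (\<lambda>m. f m + h m) m = generator_act g f m + generator_act g h m"
  by (cases g) (simp_all add: rescale_add algebra_simps smult_add_right del: mult_smult_left)

lemma generator_act_smult: "generator_act g (\<lambda>m. smult c (f m)) m = smult c (generator_act g f m)"
  by (cases g) (simp_all add: rescale_smult del: mult_smult_left)

text \<open>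
  Left multiplication in the free algebra becomes the action of generators. With
  \<open>free_alg_left_induct\<close> this is how properties of symbols are proved.
\<close>

lemma symbol_var_mult: "symbol (var g * p) m = generator_act g (symbol p) m"
proof (induction p arbitrary: m rule: free_alg_induct)
  case (single w c)
  obtain u where w: "w = Word u" by (cases w)
  have s: "symbol (Poly_Mapping.single (Word u) c) = (\<lambda>m. smult c (word_symbol (Word u) m))"
    by (rule ext) (rule symbol_single)
  show ?case unfolding w
    by (subst single_Word_Cons[symmetric])
      (simp only: s generator_act_smult, simp add: symbol_single word_symbol_def)
next
  case (add p r)
  have "symbol (p + r) = (\<lambda>m. symbol p m + symbol r m)" by (rule ext) (rule symbol_add)
  then show ?case using add by (simp only: distrib_left symbol_add generator_act_add)
qed

lemma finite_symbol: "finite {n. symbol p n \<noteq> 0}"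
proof (induction p rule: free_alg_left_induct)
  case (const c)
  show ?case by (rule finite_subset[of _ "{0}"]) (auto simp: symbol_const)
next
  case (add p r)
  show ?case by (rule finite_subset[OF _ finite_UnI[OF add]]) (auto simp: symbol_add)
next
  case (var g p)
  have "{n. symbol (var g * p) n \<noteq> 0} \<subseteq> (\<lambda>n. n + 1) ` {n. symbol p n \<noteq> 0} \<union> (\<lambda>n. n - 1) ` {n. symbol p n \<noteq> 0}"
  proof
    fix n assume "n \<in> {n. symbol (var g * p) n \<noteq> 0}"
    then have "symbol p (n - 1) \<noteq> 0 \<or> symbol p (n + 1) \<noteq> 0"
      using q_nonzero by (cases g) (auto simp: symbol_var_mult)
    then show "n \<in> (\<lambda>n. n + 1) ` {n. symbol p n \<noteq> 0} \<union> (\<lambda>n. n - 1) ` {n. symbol p n \<noteq> 0}"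
      by (auto simp: image_iff)
  qed
  then show ?case by (rule finite_subset) (use var in simp)
qed

text \<open>
  The product of \<open>\<Sum>\<^sub>n f(n)(Z) X\<^sup>n\<close> and \<open>\<Sum>\<^sub>n h(n)(Z) X\<^sup>n\<close>. It is used for \<open>f\<close> of finite support only.
\<close>

definition twisted_mult :: "(int \<Rightarrow> 'k poly) \<Rightarrow> (int \<Rightarrow> 'k poly) \<Rightarrow> int \<Rightarrow> 'k poly" where
  "twisted_mult f h m = (\<Sum>n | f n \<noteq> 0. f n * rescale (q powi (- n)) (h (m - n)))"

lemma twisted_mult_superset:
  assumes "finite W" and "{n. f n \<noteq> 0} \<subseteq> W"
  shows "twisted_mult f h m = (\<Sum>n\<in>W. f n * rescale (q powi (- n)) (h (m - n)))"
  unfolding twisted_mult_def by (rule sum.mono_neutral_left) (use assms in auto)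

lemma twisted_mult_single_term:
  assumes f: "finite {n. f n \<noteq> 0}" and other: "\<And>n. n \<noteq> i \<Longrightarrow> f n = 0 \<or> h (m - n) = 0"
  shows "twisted_mult f h m = f i * rescale (q powi (- i)) (h (m - i))"
proof -
  have "twisted_mult f h m =
      (\<Sum>n\<in>insert i {n. f n \<noteq> 0}. f n * rescale (q powi (- n)) (h (m - n)))"
    by (rule twisted_mult_superset) (use f in auto)
  also have "\<dots> = (\<Sum>n\<in>{i}. f n * rescale (q powi (- n)) (h (m - n)))"
    by (rule sum.mono_neutral_right) (use f other in fastforce)+
  finally show ?thesis by simp
qed

lemma twisted_mult_single:
  assumes "\<And>n. n \<noteq> i \<Longrightarrow> f n = 0"
  shows "twisted_mult f h m = f i * rescale (q powi (- i)) (h (m - i))"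
proof (rule twisted_mult_single_term)
  show "finite {n. f n \<noteq> 0}" by (rule finite_subset[of _ "{i}"]) (use assms in auto)
qed (use assms in auto)

text \<open>
  Associativity of the twisted product with \<open>X\<close> or \<open>Y\<close> as the first factor. Since all symbols are built
  from the unit by such factors, multiplicativity of symbols follows.
\<close>

lemma twisted_mult_generator_act:
  assumes f: "finite {n. f n \<noteq> 0}"
  shows "twisted_mult (generator_act g f) h m = generator_act g (twisted_mult f h) m"
proof (cases g)
  case GenX
  let ?W = "{n. f n \<noteq> 0}"
  have "twisted_mult (generator_act g f) h m =
      (\<Sum>n\<in>(\<lambda>n. n + 1) ` ?W. generator_act g f n * rescale (q powi (- n)) (h (m - n)))"
  proof (rule twisted_mult_superset)
    show "{n. generator_act g f n \<noteq> 0} \<subseteq> (\<lambda>n. n + 1) ` ?W"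
    proof
      fix n assume "n \<in> {n. generator_act g f n \<noteq> 0}"
      then have "n - 1 \<in> ?W" by (auto simp: GenX q_nonzero)
      then show "n \<in> (\<lambda>n. n + 1) ` ?W" by (rule rev_image_eqI) simp
    qed
  qed (use f in simp)
  also have "\<dots> = (\<Sum>n\<in>?W. rescale (inverse q) (f n) * rescale (q powi (- n - 1)) (h (m - 1 - n)))"
    by (subst sum.reindex) (auto simp: inj_on_def GenX algebra_simps intro!: sum.cong)
  also have "\<dots> = generator_act g (twisted_mult f h) m"
    by (simp add: GenX twisted_mult_def rescale_sum rescale_mult rescale_rescale power_int_diff
        q_nonzero field_simps)
  finally show ?thesis .
next
  case GenY
  let ?W = "{n. f n \<noteq> 0}"
  have "twisted_mult (generator_act g f) h m =
      (\<Sum>n\<in>(\<lambda>n. n - 1) ` ?W. generator_act g f n * rescale (q powi (- n)) (h (m - n)))"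
  proof (rule twisted_mult_superset)
    show "{n. generator_act g f n \<noteq> 0} \<subseteq> (\<lambda>n. n - 1) ` ?W"
    proof
      fix n assume "n \<in> {n. generator_act g f n \<noteq> 0}"
      then have "n + 1 \<in> ?W" by (auto simp: GenY q_nonzero)
      then show "n \<in> (\<lambda>n. n - 1) ` ?W" by (rule rev_image_eqI) simp
    qed
  qed (use f in simp)
  also have "\<dots> = (\<Sum>n\<in>?W. (smult (inverse (q - 1)) [:- 1, q:] * rescale q (f n)) *
      rescale (q powi (1 - n)) (h (m + 1 - n)))"
    by (subst sum.reindex) (auto simp: inj_on_def GenY algebra_simps simp del: mult_smult_left smult_pCons intro!: sum.cong)
  also have "\<dots> = smult (inverse (q - 1)) [:- 1, q:] *
      (\<Sum>n\<in>?W. rescale q (f n) * rescale (q powi (1 - n)) (h (m + 1 - n)))"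
    by (simp only: sum_distrib_left mult.assoc)
  also have "\<dots> = generator_act g (twisted_mult f h) m"
    by (simp add: GenY twisted_mult_def rescale_sum rescale_mult rescale_rescale power_int_diff
        power_int_minus divide_inverse q_nonzero del: mult_smult_left smult_pCons)
  finally show ?thesis .
qed

lemma symbol_mult: "symbol (p * r) m = twisted_mult (symbol p) (symbol r) m"
proof (induction p arbitrary: m rule: free_alg_left_induct)
  case (const c)
  show ?case
    by (subst twisted_mult_single[of 0]) (simp_all add: symbol_const symbol_const_mult)
next
  case (add p s)
  let ?W = "{n. symbol p n \<noteq> 0} \<union> {n. symbol s n \<noteq> 0}"
  have W: "finite ?W" using finite_symbol by simp
  have "{n. symbol (p + s) n \<noteq> 0} \<subseteq> ?W" by (auto simp: symbol_add)
  then show ?case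
    using add W
    by (simp add: distrib_right symbol_add twisted_mult_superset[of ?W] sum.distrib)
next
  case (var g p)
  have s: "symbol (var g * r) = generator_act g (symbol r)" for r
    by (rule ext) (rule symbol_var_mult)
  have "symbol (p * r) = twisted_mult (symbol p) (symbol r)"
    by (rule ext) (rule var)
  then show ?case
    by (simp add: mult.assoc s twisted_mult_generator_act[OF finite_symbol])
qed


lemma symbol_var:
  "symbol (var GenX) m = (if m = 1 then 1 else 0)"
  "symbol (var GenY) m = (if m = - 1 then smult (inverse (q - 1)) [:- 1, q:] else 0)"
  using symbol_var_mult[of GenX 1 m] symbol_var_mult[of GenY 1 m] by (auto simp: symbol_one)

text \<open>
  The normal element \<open>Z\<close>. The elements of weight zero are the polynomials in \<open>Z\<close>.
\<close>

definition commutator_YX :: "(generator, 'k) free_alg" where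
  "commutator_YX = var GenY * var GenX - var GenX * var GenY"

lemma symbol_YX: "symbol (var GenY * var GenX) m =
    (if m = 0 then smult (inverse (q - 1)) [:- 1, q:] else 0)"
  by (simp add: symbol_var_mult symbol_var)

lemma symbol_XY: "symbol (var GenX * var GenY) m =
    (if m = 0 then smult (inverse (q - 1)) [:- 1, 1:] else 0)"
  using q_nonzero by (auto simp: symbol_var_mult symbol_var rescale_pCons)

lemma symbol_commutator_YX: "symbol commutator_YX m = (if m = 0 then [:0, 1:] else 0)"
proof -
  have "inverse (q - 1) * q - inverse (q - 1) = 1"
    using left_inverse[of "q - 1"] q_not_one by (simp add: right_diff_distrib)
  then show ?thesis by (simp add: commutator_YX_def symbol_diff symbol_YX symbol_XY)
qed

lemma symbol_commutator_YX_mult: "symbol (commutator_YX * p) m = [:0, 1:] * symbol p m"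
  unfolding symbol_mult
  by (subst twisted_mult_single[of 0]) (simp_all add: symbol_commutator_YX)

text \<open>
  The elements with zero symbol form a two-sided ideal by \<open>symbol_mult\<close>, and the defining relation
  belongs to it.
\<close>

lemma symbol_ideal:
  assumes "p \<in> qweyl_ideal q"
  shows "symbol p m = 0"
proof -
  let ?F = "free_algebra :: ('k, (generator, 'k) free_alg) module"
  let ?r = "var GenY * var GenX - const q * var GenX * var GenY - 1"
  interpret ring ?F by (rule ring_free_algebra)
  define J where "J = {p. \<forall>m. symbol p m = 0}"
  have inv: "\<ominus>\<^bsub>?F\<^esub> x = - x" for x by (rule minus_equality) simp_all
  have "ideal J ?F"
  proof (rule idealI)
    show "subgroup J (add_monoid ?F)"
    proof (rule add.subgroupI)
      show "J \<noteq> {}" using symbol_zero by (auto simp: J_def)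
    qed (auto simp: J_def inv symbol_uminus symbol_add)
  qed (auto simp: J_def symbol_mult twisted_mult_def ring_free_algebra)
  moreover have "?r \<in> J"
  proof -
    have "inverse (q - 1) * q - q * inverse (q - 1) = 0" "q * inverse (q - 1) - inverse (q - 1) = 1"
      using left_inverse[of "q - 1"] q_not_one by (simp_all add: algebra_simps)
    then show ?thesis
      by (auto simp: J_def symbol_diff symbol_const_mult mult.assoc symbol_YX symbol_XY symbol_one
          one_pCons)
  qed
  ultimately have "qweyl_ideal q \<subseteq> J"
    unfolding qweyl_ideal_def by (intro genideal_minimal) auto
  then show ?thesis using assms by (auto simp: J_def)
qed

section \<open>Ordered monomials and faithfulness of symbols\<close>

definition ordered_monomial :: "nat \<times> nat \<Rightarrow> (generator, 'k) free_alg" where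
  "ordered_monomial k = var GenX ^ fst k * var GenY ^ snd k"

definition ordered_sum :: "(nat \<times> nat \<Rightarrow>\<^sub>0 'k) \<Rightarrow> (generator, 'k) free_alg" where
  "ordered_sum c =
     (\<Sum>k\<in>Poly_Mapping.keys c. const (Poly_Mapping.lookup c k) * ordered_monomial k)"

lemma ordered_sum_add: "ordered_sum (c + e) = ordered_sum c + ordered_sum e"
  unfolding ordered_sum_def
  by (rule setsum_keys_plus_distrib[of "\<lambda>k a. const a * ordered_monomial k"])
    (simp_all add: const_def single_add distrib_right)

lemma ordered_sum_single: "ordered_sum (Poly_Mapping.single k a) = const a * ordered_monomial k"
  by (simp add: ordered_sum_def const_def)

lemma var_const_left_commute:
  "var g * (const c * r) = const c * (var g * r)"
  "var g ^ n * (const c * r) = const c * (var g ^ n * r)"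
  for r :: "('g, 'k) free_alg"
  by (metis const_commute mult.assoc)+

lemma const_const_mult: "const a * (const b * r) = const (a * b) * r"
  for r :: "('g, 'k) free_alg"
  by (simp add: const_mult mult.assoc)

lemma relator_mem_ideal:
  "var GenY * var GenX - const q * (var GenX * var GenY) - 1 \<in> qweyl_ideal q"
proof -
  have "var GenY * var GenX - const q * var GenX * var GenY - 1 \<in> qweyl_ideal q"
    unfolding qweyl_ideal_def by (rule ring.genideal_self'[OF ring_free_algebra]) simp
  then show ?thesis by (simp add: mult.assoc)
qed

text \<open>
  The coefficients are \<open>q\<^sup>i\<^sup>+\<^sup>1\<close> and the \<open>q\<close>-integer \<open>1 + q + \<dots> + q\<^sup>i\<close>, but their values are irrelevant
  for spanning. Starting at \<open>Suc i\<close> keeps the exponents of the last term natural.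
\<close>

lemma Y_X_power_commute:
  "\<exists>a b. var GenY * var GenX ^ Suc i -
     (const a * (var GenX ^ Suc i * var GenY) + const b * var GenX ^ i) \<in> qweyl_ideal q"
proof (induction i)
  case 0
  show ?case
    using relator_mem_ideal
    by (intro exI[of _ q] exI[of _ 1]) (simp add: const_one algebra_simps)
next
  case (Suc i)
  let ?X = "var GenX" and ?Y = "var GenY"
  obtain a b where ab: "?Y * ?X ^ Suc i - (const a * (?X ^ Suc i * ?Y) + const b * ?X ^ i) \<in> qweyl_ideal q"
    using Suc by blast
  have "(?Y * ?X - const q * (?X * ?Y) - 1) * ?X ^ Suc i + (const q * ?X) *
      (?Y * ?X ^ Suc i - (const a * (?X ^ Suc i * ?Y) + const b * ?X ^ i)) =
    ?Y * ?X ^ Suc (Suc i) - (const (q * a) * (?X ^ Suc (Suc i) * ?Y) + const (q * b + 1) * ?X ^ Suc i)"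
    by (simp add: const_const_mult const_add const_one var_const_left_commute algebra_simps)
  moreover have "\<dots> \<in> qweyl_ideal q"
    unfolding calculation[symmetric]
    by (intro qweyl_ideal_closed(2) qweyl_ideal_closed(3)[OF ab] qweyl_ideal_closed(4)
        relator_mem_ideal)
  ultimately show ?case by blast
qed

text \<open>
  The ordered monomials span the quotient: left multiplication by \<open>X\<close> maps them to each other, and
  \<open>Y\<close> can be moved to the right of \<open>X\<^sup>i\<close> by the preceding lemma.
\<close>

lemma congruent_ordered_sum: "\<exists>c. p - ordered_sum c \<in> qweyl_ideal q"
proof -
  define N where "N = {p. \<exists>c. p - ordered_sum c \<in> qweyl_ideal q}"
  have ideal: "p \<in> N" if "p \<in> qweyl_ideal q" for p
    using that unfolding N_def by (auto intro!: exI[of _ 0] simp: ordered_sum_def)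
  have add: "p + r \<in> N" if pr: "p \<in> N" "r \<in> N" for p r
  proof -
    obtain c e where "p - ordered_sum c \<in> qweyl_ideal q" "r - ordered_sum e \<in> qweyl_ideal q"
      using pr by (auto simp: N_def)
    from qweyl_ideal_closed(2)[OF this] show ?thesis
      unfolding N_def by (auto intro!: exI[of _ "c + e"] simp: ordered_sum_add algebra_simps)
  qed
  have sum: "sum f W \<in> N" if "\<And>k. k \<in> W \<Longrightarrow> f k \<in> N" for f :: "nat \<times> nat \<Rightarrow> _" and W
    using that by (induction W rule: infinite_finite_induct) (auto intro: add ideal qweyl_ideal_closed(1))
  have monomial: "const a * ordered_monomial k \<in> N" for a k
    unfolding N_def
    by (auto intro!: exI[of _ "Poly_Mapping.single k a"] simp: ordered_sum_single qweyl_ideal_closed(1))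
  have var_monomial: "var g * (const a * ordered_monomial k) \<in> N" for g a k
  proof (cases g)
    case GenX
    have "var g * (const a * ordered_monomial k) = const a * ordered_monomial (Suc (fst k), snd k)"
      by (simp add: GenX ordered_monomial_def var_const_left_commute mult.assoc)
    then show ?thesis by (simp add: monomial)
  next
    case GenY
    show ?thesis
    proof (cases "fst k")
      case 0
      have "var g * (const a * ordered_monomial k) = const a * ordered_monomial (0, Suc (snd k))"
        by (simp add: GenY 0 ordered_monomial_def var_const_left_commute)
      then show ?thesis by (simp add: monomial)
    next
      case (Suc i)
      let ?X = "var GenX" and ?Y = "var GenY"
      obtain b e where be: "?Y * ?X ^ Suc i - (const b * (?X ^ Suc i * ?Y) + const e * ?X ^ i) \<in> qweyl_ideal q"
        using Y_X_power_commute by blast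
      have "var g * (const a * ordered_monomial k) =
        const a * (?Y * ?X ^ Suc i - (const b * (?X ^ Suc i * ?Y) + const e * ?X ^ i)) * ?Y ^ snd k +
        (const (a * b) * ordered_monomial (Suc i, Suc (snd k)) + const (a * e) * ordered_monomial (i, snd k))"
        by (simp add: GenY Suc ordered_monomial_def var_const_left_commute const_const_mult algebra_simps
            del: power_Suc) (simp add: power_Suc)
      also have "\<dots> \<in> N"
        by (intro add monomial ideal qweyl_ideal_closed(4) qweyl_ideal_closed(3)[OF be])
      finally show ?thesis .
    qed
  qed
  have "p \<in> N"
  proof (induction p rule: free_alg_left_induct)
    case (const c)
    show ?case using monomial[of c "(0, 0)"] by (simp add: ordered_monomial_def)
  next
    case (var g p)
    obtain c where c: "p - ordered_sum c \<in> qweyl_ideal q"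
      using var by (auto simp: N_def)
    have "var g * p = var g * (p - ordered_sum c) + var g * ordered_sum c"
      by (simp add: algebra_simps)
    moreover have "var g * ordered_sum c \<in> N"
      unfolding ordered_sum_def sum_distrib_left by (rule sum) (rule var_monomial)
    ultimately show ?case
      using add[OF ideal[OF qweyl_ideal_closed(3)[OF c]]] by simp
  qed (rule add)
  then show ?thesis by (simp add: N_def)
qed

lemma symbol_X_power_mult:
  "symbol (var GenX ^ i * r) m = rescale (inverse q ^ i) (symbol r (m - int i))"
  by (induction i arbitrary: m)
    (simp_all add: mult.assoc symbol_var_mult rescale_rescale algebra_simps)

lemma symbol_Y_power:
  "\<exists>P. P \<noteq> 0 \<and> Polynomial.degree P = j \<and>
    (\<forall>m. symbol (var GenY ^ j) m = (if m = - int j then P else 0))"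
proof (induction j)
  case 0
  show ?case by (rule exI[of _ 1]) (simp add: symbol_one)
next
  case (Suc j)
  then obtain P where P: "P \<noteq> 0" "Polynomial.degree P = j"
    "\<And>m. symbol (var GenY ^ j) m = (if m = - int j then P else 0)" by blast
  let ?u = "smult (inverse (q - 1)) [:- 1, q:]"
  have u: "?u \<noteq> 0" "Polynomial.degree ?u = 1" using q_nonzero q_not_one by auto
  show ?case
  proof (intro exI[of _ "?u * rescale q P"] conjI allI)
    show "?u * rescale q P \<noteq> 0" using u P q_nonzero by (simp del: smult_pCons mult_smult_left)
    show "Polynomial.degree (?u * rescale q P) = Suc j"
      using u P q_nonzero by (subst degree_mult_eq) (simp_all del: smult_pCons mult_smult_left)
    show "symbol (var GenY ^ Suc j) m = (if m = - int (Suc j) then ?u * rescale q P else 0)" for m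
      by (auto simp: symbol_var_mult P(3) del: smult_pCons mult_smult_left)
  qed
qed

lemma symbol_ordered_monomial:
  "\<exists>P. P \<noteq> 0 \<and> Polynomial.degree P = j \<and>
    (\<forall>m. symbol (ordered_monomial (i, j)) m = (if m = int i - int j then P else 0))"
proof -
  obtain P where P: "P \<noteq> 0" "Polynomial.degree P = j"
    "\<And>m. symbol (var GenY ^ j) m = (if m = - int j then P else 0)"
    using symbol_Y_power by blast
  have "inverse q ^ i \<noteq> 0" using q_nonzero by simp
  then show ?thesis
    by (intro exI[of _ "rescale (inverse q ^ i) P"])
      (auto simp: P ordered_monomial_def symbol_X_power_mult)
qed

text \<open>
  The monomial \<open>X\<^sup>i Y\<^sup>j\<close> contributes a polynomial of degree exactly \<open>j\<close> at the position \<open>i - j\<close>. At a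
  position where the largest \<open>j\<close> occurs, the leading coefficient comes from a single monomial and
  cannot cancel.
\<close>

lemma ordered_sum_independent:
  assumes zero: "\<And>m. symbol (ordered_sum c) m = 0"
  shows "c = 0"
proof (rule ccontr)
  assume "c \<noteq> 0"
  let ?K = "Poly_Mapping.keys c"
  have K: "finite ?K" "?K \<noteq> {}" using \<open>c \<noteq> 0\<close> by auto
  define J where "J = Max (snd ` ?K)"
  have J: "snd k \<le> J" if "k \<in> ?K" for k
    using that K by (simp add: J_def)
  have "J \<in> snd ` ?K" unfolding J_def using K by (intro Max_in) auto
  then obtain i where i: "(i, J) \<in> ?K" by auto
  let ?m = "int i - int J"
  obtain P where P: "P \<noteq> 0" "Polynomial.degree P = J" "symbol (ordered_monomial (i, J)) ?m = P"
    using symbol_ordered_monomial[of J i] by auto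
  have other: "poly.coeff (symbol (ordered_monomial k) ?m) J = 0" if k: "k \<in> ?K - {(i, J)}" for k
  proof -
    obtain i' j' where k': "k = (i', j')" by (cases k)
    obtain R where R: "Polynomial.degree R = j'"
      "\<And>m. symbol (ordered_monomial (i', j')) m = (if m = int i' - int j' then R else 0)"
      using symbol_ordered_monomial[of j' i'] by auto
    have "j' < J" if "?m = int i' - int j'"
      using that J[of k] k k' by auto
    then show ?thesis by (auto simp: k' R coeff_eq_0)
  qed
  have "0 = poly.coeff (symbol (ordered_sum c) ?m) J" by (simp add: zero)
  also have "\<dots> = (\<Sum>k\<in>?K. Poly_Mapping.lookup c k * poly.coeff (symbol (ordered_monomial k) ?m) J)"
    by (simp add: ordered_sum_def symbol_sum symbol_const_mult coeff_sum)
  also have "\<dots> = Poly_Mapping.lookup c (i, J) * poly.coeff P J"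
    using other by (subst sum.remove[OF K(1) i]) (simp add: P(3))
  finally have "Poly_Mapping.lookup c (i, J) = 0" using P by (metis leading_coeff_0_iff mult_eq_0_iff)
  then show False using i by (simp add: in_keys_iff)
qed

text \<open>
  Symbols embed the quotient algebra into the twisted Laurent polynomials.
\<close>

lemma symbol_eq_zero_iff: "(\<forall>m. symbol p m = 0) \<longleftrightarrow> p \<in> qweyl_ideal q"
proof
  assume *: "\<forall>m. symbol p m = 0"
  obtain c where c: "p - ordered_sum c \<in> qweyl_ideal q" using congruent_ordered_sum by blast
  then have "symbol (ordered_sum c) m = 0" for m
    using symbol_ideal[OF c, of m] * by (simp add: symbol_diff)
  then have "c = 0" by (rule ordered_sum_independent)
  then show "p \<in> qweyl_ideal q" using c by (simp add: ordered_sum_def)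
qed (simp add: symbol_ideal)

lemma qweyl_class_eq_iff: "qweyl_class q p = qweyl_class q r \<longleftrightarrow> symbol p = symbol r"
  unfolding qweyl_coset_eq_iff symbol_eq_zero_iff[symmetric] by (auto simp: symbol_diff fun_eq_iff)

end

section \<open>Weights, divisibility by Y and commutators\<close>

definition weight :: "generator free_monoid \<Rightarrow> int" where
  "weight w = int (count_list (letters w) GenX) - int (count_list (letters w) GenY)"

context quantum_weyl begin

lemma word_symbol_weight: "m \<noteq> weight w \<Longrightarrow> word_symbol w m = 0"
proof -
  have "m \<noteq> weight (Word u) \<Longrightarrow> word_symbol (Word u) m = 0" for u m
  proof (induction u arbitrary: m)
    case Nil
    then show ?case by (simp add: weight_def word_symbol_def unit_symbol_def)
  next
    case (Cons g u)
    then show ?case by (cases g) (simp_all add: weight_def word_symbol_def)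
  qed
  then show "m \<noteq> weight w \<Longrightarrow> word_symbol w m = 0" by (metis free_monoid.collapse)
qed

definition restrict_weights :: "int set \<Rightarrow> (generator, 'k) free_alg \<Rightarrow> (generator, 'k) free_alg" where
  "restrict_weights R p = Poly_Mapping.mapp (\<lambda>w c. if weight w \<in> R then c else 0) p"

lemma lookup_restrict_weights:
  "Poly_Mapping.lookup (restrict_weights R p) w =
    (if weight w \<in> R then Poly_Mapping.lookup p w else 0)"
  by (cases "w \<in> Poly_Mapping.keys p") (simp_all add: restrict_weights_def mapp.rep_eq in_keys_iff)

lemma symbol_restrict_weights:
  "symbol (restrict_weights R p) m = (if m \<in> R then symbol p m else 0)"
proof (induction p rule: free_alg_induct)
  case (single w c)
  have "restrict_weights R (Poly_Mapping.single w c) =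
      (if weight w \<in> R then Poly_Mapping.single w c else 0)"
    by (intro poly_mapping_eqI) (auto simp: lookup_restrict_weights lookup_single when_def)
  then show ?case
    using word_symbol_weight[of m w] by (auto simp: symbol_single symbol_zero)
next
  case (add p r)
  have "restrict_weights R (p + r) = restrict_weights R p + restrict_weights R r"
    by (intro poly_mapping_eqI) (simp add: lookup_restrict_weights lookup_add)
  then show ?case using add by (simp add: symbol_add)
qed

text \<open>
  Parts of a weight in which the symbol vanishes lie in the ideal and may be dropped. For
  the remaining representative, a bound on the support of the symbol also bounds the weights of the
  words.
\<close>

lemma reduced_representative:
  obtains r where "symbol r = symbol p"
    and "\<And>w. w \<in> Poly_Mapping.keys r \<Longrightarrow> symbol p (weight w) \<noteq> 0"
proof
  let ?r = "restrict_weights {n. symbol p n \<noteq> 0} p"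
  show "symbol ?r = symbol p" by (auto simp: symbol_restrict_weights)
  show "symbol p (weight w) \<noteq> 0" if "w \<in> Poly_Mapping.keys ?r" for w
    using that by (auto simp: in_keys_iff lookup_restrict_weights split: if_splits)
qed

text \<open>
  This separates the image of the quotient from elements such as \<open>X\<^sup>-\<^sup>1\<close>: the part of weight
  \<open>n < 0\<close> is \<open>R(Z) Y\<^sup>-\<^sup>n\<close> for some \<open>R\<close>, and the rightmost \<open>Y\<close> contributes the root \<open>q\<^sup>n\<close>.
\<close>

lemma symbol_negative_vanishes: "n < 0 \<Longrightarrow> poly (symbol p n) (q powi n) = 0"
proof (induction p arbitrary: n rule: free_alg_left_induct)
  case (const c)
  then show ?case by (simp add: symbol_const)
next
  case (add p r)
  then show ?case by (simp add: symbol_add)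
next
  case (var g p)
  show ?case
  proof (cases g)
    case GenX
    have "inverse q * q powi n = q powi (n - 1)"
      using q_nonzero by (simp add: power_int_diff field_simps)
    then show ?thesis using var.IH[of "n - 1"] var.prems
      by (simp add: GenX symbol_var_mult poly_rescale)
  next
    case GenY
    have *: "q * q powi n = q powi (n + 1)"
      using q_nonzero by (simp add: power_int_add field_simps)
    show ?thesis
    proof (cases "n = - 1")
      case True
      then show ?thesis using * by (simp add: GenY symbol_var_mult mult.commute)
    next
      case False
      then show ?thesis using var.IH[of "n + 1"] var.prems *
        by (simp add: GenY symbol_var_mult poly_rescale)
    qed
  qed
qed

text \<open>
  Modulo \<open>Z\<close> the generators commute, and \<open>Z\<close> commutes with each generator up to a scalar, so the
  left multiples of \<open>Z\<close> absorb multiplication by generators from the left.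
\<close>

lemma commutator_divisible:
  "\<exists>b. symbol (p * var g - var g * p) = symbol (commutator_YX * b)"
proof (induction p rule: free_alg_left_induct)
  case (const c)
  show ?case by (rule exI[of _ 0]) (simp add: fun_eq_iff const_commute symbol_zero)
next
  case (add p r)
  then obtain b e where "symbol (p * var g - var g * p) = symbol (commutator_YX * b)"
    "symbol (r * var g - var g * r) = symbol (commutator_YX * e)" by blast
  then show ?case
    by (intro exI[of _ "b + e"]) (simp add: fun_eq_iff algebra_simps symbol_add symbol_diff)
next
  case (var h p)
  then obtain b where b: "symbol (p * var g - var g * p) = symbol (commutator_YX * b)" by blast
  \<comment> \<open>The scalars are \<open>1/q\<close> for \<open>X\<close> and \<open>q\<close> for \<open>Y\<close>.\<close>
  have c: "\<exists>a. \<forall>m. symbol (var h * (commutator_YX * r)) m =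
      symbol (commutator_YX * (const a * (var h * r))) m" for r
  proof (cases h)
    case GenX
    show ?thesis
      by (intro exI[of _ "inverse q"])
        (simp add: GenX symbol_var_mult symbol_commutator_YX_mult symbol_const_mult rescale_mult
          rescale_pCons)
  next
    case GenY
    show ?thesis
      by (intro exI[of _ q])
        (simp add: GenY symbol_var_mult symbol_commutator_YX_mult symbol_const_mult rescale_mult
          rescale_pCons smult_diff_right algebra_simps)
  qed
  obtain a where a: "symbol (var h * (commutator_YX * b)) =
      symbol (commutator_YX * (const a * (var h * b)))" using c by blast
  obtain e where e: "var h * var g - var g * var h = commutator_YX * const e"
  proof (cases "h = g")
    case True
    then show ?thesis using that[of 0] by (simp add: const_def)
  next
    case False
    then have "h = GenY \<and> g = GenX \<or> h = GenX \<and> g = GenY" by (cases h; cases g) simp_all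
    then show ?thesis using that[of 1] that[of "- 1"]
      by (auto simp: commutator_YX_def const_def single_uminus)
  qed
  have "var h * p * var g - var g * (var h * p) =
      var h * (p * var g - var g * p) + (var h * var g - var g * var h) * p"
    by (simp add: algebra_simps)
  also have "symbol \<dots> = symbol (commutator_YX * (const a * (var h * b) + const e * p))"
    using a by (simp add: e b fun_eq_iff symbol_add distrib_left symbol_var_mult mult.assoc)
  finally show ?case by blast
qed

end

section \<open>Filtrations by weight\<close>

lemma weight_add: "weight (u + v) = weight u + weight v"
  by (simp add: weight_def plus_free_monoid_def)

text \<open>
  The factor \<open>s\<close> is \<open>1\<close> or \<open>-1\<close> in all applications, so that bounds from above and from below on the
  weights are treated by the same statements.
\<close>

definition filtered :: "int \<Rightarrow> int \<Rightarrow> (generator, 'k::field) free_alg set" where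
  "filtered s i = {p. \<forall>w\<in>Poly_Mapping.keys p. s * weight w \<le> i}"

lemma filtered_mono: "p \<in> filtered s i \<Longrightarrow> i \<le> j \<Longrightarrow> p \<in> filtered s j"
  by (force simp: filtered_def)

lemma filtered_add: "p \<in> filtered s i \<Longrightarrow> r \<in> filtered s i \<Longrightarrow> p + r \<in> filtered s i"
  using keys_add[of p r] by (auto simp: filtered_def)

lemma filtered_zero: "0 \<in> filtered s i"
  by (simp add: filtered_def)

lemma filtered_sum: "(\<And>w. w \<in> W \<Longrightarrow> f w \<in> filtered s i) \<Longrightarrow> sum f W \<in> filtered s i"
  by (induction W rule: infinite_finite_induct) (auto intro: filtered_add filtered_zero)

lemma filtered_mult:
  assumes "p \<in> filtered s i" and "r \<in> filtered s j"
  shows "p * r \<in> filtered s (i + j)"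
  unfolding filtered_def
proof (intro CollectI ballI)
  fix w assume "w \<in> Poly_Mapping.keys (p * r)"
  then obtain u v where w: "w = u + v" "u \<in> Poly_Mapping.keys p" "v \<in> Poly_Mapping.keys r"
    using keys_mult[of p r] by blast
  then have "s * weight u \<le> i" "s * weight v \<le> j"
    using assms by (auto simp: filtered_def)
  then show "s * weight w \<le> i + j" by (simp add: w weight_add distrib_left)
qed

lemma filtered_single: "s * weight w \<le> i \<Longrightarrow> Poly_Mapping.single w c \<in> filtered s i"
  by (auto simp: filtered_def)

lemma filtered_const: "const c \<in> filtered s 0"
  unfolding const_def by (rule filtered_single) (simp add: weight_def zero_free_monoid_def)

lemma filtered_var: "var GenX \<in> filtered s s" "var GenY \<in> filtered s (- s)"
  unfolding var_def by (auto intro!: filtered_single simp: weight_def)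

lemma (in free_alg_derivation) expand_words:
  "d p = (\<Sum>w\<in>Poly_Mapping.keys p. const (Poly_Mapping.lookup p w) * d (Poly_Mapping.single w 1))"
proof (induction p rule: free_alg_induct)
  case (single w c)
  have "Poly_Mapping.single w c = const c * Poly_Mapping.single w 1"
    by (simp add: const_def mult_single)
  then have "d (Poly_Mapping.single w c) = const c * d (Poly_Mapping.single w 1)"
    by (simp only: const_mult)
  then show ?case by (cases "c = 0") (simp_all add: zero)
next
  case (add p r)
  have "(\<Sum>w\<in>Poly_Mapping.keys (p + r).
        const (Poly_Mapping.lookup (p + r) w) * d (Poly_Mapping.single w 1)) =
      (\<Sum>w\<in>Poly_Mapping.keys p. const (Poly_Mapping.lookup p w) * d (Poly_Mapping.single w 1)) +
      (\<Sum>w\<in>Poly_Mapping.keys r. const (Poly_Mapping.lookup r w) * d (Poly_Mapping.single w 1))"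
    by (rule setsum_keys_plus_distrib[of "\<lambda>w c. const c * d (Poly_Mapping.single w 1)"])
      (simp_all add: const_def single_add distrib_right)
  then show ?case using add by (simp add: free_alg_derivation.add[OF free_alg_derivation_axioms])
qed

text \<open>
  By the Leibniz rule, a bound on how far a derivation raises the weights of the generators is a
  bound for all elements.
\<close>

lemma filtered_derivation:
  assumes d: "free_alg_derivation d"
    and X: "d (var GenX) \<in> filtered s (s + M)" and Y: "d (var GenY) \<in> filtered s (- s + M)"
    and p: "p \<in> filtered s i"
  shows "d p \<in> filtered s (i + M)"
proof -
  interpret free_alg_derivation d by (rule d)
  have word: "d (Poly_Mapping.single (Word u) 1) \<in> filtered s (s * weight (Word u) + M)" for u
  proof (induction u)
    case Nil
    have "d (Poly_Mapping.single (Word []) 1) = 0"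
      using one by (simp flip: zero_free_monoid_def)
    then show ?case by (simp add: filtered_zero)
  next
    case (Cons g u)
    let ?e = "if g = GenX then 1 else - 1 :: int"
    have wt: "weight (Word (g # u)) = ?e + weight (Word u)"
      by (cases g) (simp_all add: weight_def)
    have g: "d (var g) \<in> filtered s (s * ?e + M)" "var g \<in> filtered s (s * ?e)"
      using X Y filtered_var[of s] by (cases g; simp)+
    have u: "Poly_Mapping.single (Word u) 1 \<in> filtered s (s * weight (Word u))"
      by (rule filtered_single) simp
    have "d (var g) * Poly_Mapping.single (Word u) 1 + var g * d (Poly_Mapping.single (Word u) 1)
        \<in> filtered s (s * weight (Word (g # u)) + M)"
      by (rule filtered_add)
        (use filtered_mult[OF g(1) u] filtered_mult[OF g(2) Cons] in \<open>simp_all add: wt algebra_simps\<close>)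
    then show ?case by (simp add: single_Word_Cons mult)
  qed
  show ?thesis
    unfolding expand_words[of p]
  proof (rule filtered_sum)
    fix w assume w: "w \<in> Poly_Mapping.keys p"
    have "const (Poly_Mapping.lookup p w) * d (Poly_Mapping.single w 1) \<in> filtered s (s * weight w + M)"
      using filtered_mult[OF filtered_const word[of "letters w"]] by simp
    then show "const (Poly_Mapping.lookup p w) * d (Poly_Mapping.single w 1) \<in> filtered s (i + M)"
      by (rule filtered_mono) (use w p in \<open>auto simp: filtered_def\<close>)
  qed
qed

context quantum_weyl begin

lemma symbol_filtered: "p \<in> filtered s i \<Longrightarrow> i < s * k \<Longrightarrow> symbol p k = 0"
  unfolding symbol_def filtered_def
  by (intro sum.neutral ballI) (metis (mono_tags, lifting) mem_Collect_eq not_less smult_0_right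
      word_symbol_weight)

text \<open>
  In the twisted convolution only one term reaches the top weight \<open>i + j\<close>, so there is no
  cancellation. The condition on \<open>s\<close> says that it is \<open>1\<close> or \<open>-1\<close>.
\<close>

lemma symbol_top_mult:
  assumes s: "s * s = 1" and p: "p \<in> filtered s i" and r: "r \<in> filtered s j"
  shows "symbol (p * r) (s * (i + j)) =
    symbol p (s * i) * rescale (q powi (- (s * i))) (symbol r (s * j))"
proof -
  have ss: "s * (s * k) = k" for k by (simp add: s flip: mult.assoc)
  have "symbol p n = 0 \<or> symbol r (s * (i + j) - n) = 0" if "n \<noteq> s * i" for n
  proof -
    have "s * n \<noteq> i" using that ss[of n] by auto
    then consider "i < s * n" | "j < s * (s * (i + j) - n)"
      by (fastforce simp: right_diff_distrib ss)
    then show ?thesis using symbol_filtered[OF p] symbol_filtered[OF r] by cases auto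
  qed
  then show ?thesis
    by (subst symbol_mult, subst twisted_mult_single_term[of _ "s * i"])
      (auto simp: finite_symbol distrib_left)
qed

end

section \<open>Locally finite derivations preserve weights\<close>

text \<open>
  A lift of a locally finite derivation of the quotient. Boundedness is all that is used of local
  finiteness: a finite-dimensional space of twisted Laurent polynomials has bounded exponents of
  \<open>X\<close> and of \<open>Z\<close>. Values on generators can be chosen reduced by \<open>reduced_representative\<close>.
\<close>

locale locally_finite_lift = quantum_weyl q + free_alg_derivation d
  for q :: "'k::field_char_0" and d +
  assumes respects: "symbol p = symbol r \<Longrightarrow> symbol (d p) = symbol (d r)"
    and bounded: "\<exists>N. \<forall>n k. (int N < \<bar>k\<bar> \<longrightarrow> symbol ((d ^^ n) p) k = 0) \<and>
      Polynomial.degree (symbol ((d ^^ n) p) k) \<le> N"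
    and reduced: "w \<in> Poly_Mapping.keys (d (var g)) \<Longrightarrow> symbol (d (var g)) (weight w) \<noteq> 0"
begin

lemma iterate_respects: "symbol p = symbol r \<Longrightarrow> symbol ((d ^^ n) p) = symbol ((d ^^ n) r)"
  by (induction n) (auto intro: respects)

text \<open>
  The image of \<open>Z = YX - XY\<close> is a sum of two commutators with a generator.
\<close>

lemma derivation_commutator_YX:
  "\<exists>b. symbol (d commutator_YX) = symbol (commutator_YX * b)"
proof -
  obtain b where b: "symbol (d (var GenY) * var GenX - var GenX * d (var GenY)) =
      symbol (commutator_YX * b)"
    using commutator_divisible by blast
  obtain e where e: "symbol (d (var GenX) * var GenY - var GenY * d (var GenX)) =
      symbol (commutator_YX * e)"
    using commutator_divisible by blast
  have "d commutator_YX = (d (var GenY) * var GenX - var GenX * d (var GenY)) -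
      (d (var GenX) * var GenY - var GenY * d (var GenX))"
    by (simp add: commutator_YX_def diff mult algebra_simps)
  also have "symbol \<dots> = symbol (commutator_YX * (b - e))"
    by (rule ext) (simp only: symbol_diff[of "_ - _"] b e symbol_diff right_diff_distrib)
  finally show ?thesis by blast
qed

lemma iterate_filtered:
  assumes "d (var GenX) \<in> filtered s (s + M)" and "d (var GenY) \<in> filtered s (- s + M)"
    and "p \<in> filtered s i"
  shows "(d ^^ n) p \<in> filtered s (i + int n * M)"
proof (induction n)
  case (Suc n)
  from filtered_derivation[OF free_alg_derivation_axioms assms(1,2) this] show ?case
    by (simp add: algebra_simps)
qed (simp add: assms)

text \<open>
  Here \<open>m\<close> and \<open>n\<close> bound the orders of \<open>p\<close> and \<open>r\<close>. In the Leibniz expansion of the top part of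
  \<open>d\<^sup>m\<^sup>+\<^sup>n (p r)\<close> every other term has more than \<open>m\<close> derivatives on \<open>p\<close> or more than \<open>n\<close> on \<open>r\<close>.
\<close>

lemma top_leibniz:
  assumes s: "s * s = 1"
    and X: "d (var GenX) \<in> filtered s (s + M)" and Y: "d (var GenY) \<in> filtered s (- s + M)"
    and p: "p \<in> filtered s i" and r: "r \<in> filtered s j"
    and m: "\<And>k. m < k \<Longrightarrow> symbol ((d ^^ k) p) (s * (i + int k * M)) = 0"
    and n: "\<And>k. n < k \<Longrightarrow> symbol ((d ^^ k) r) (s * (j + int k * M)) = 0"
  shows "symbol ((d ^^ (m + n)) (p * r)) (s * (i + j + int (m + n) * M)) =
    of_nat ((m + n) choose m) * (symbol ((d ^^ m) p) (s * (i + int m * M)) *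
      rescale (q powi (- (s * (i + int m * M)))) (symbol ((d ^^ n) r) (s * (j + int n * M))))"
    (is "?lhs = ?t m")
proof -
  let ?f = "\<lambda>k. of_nat ((m + n) choose k) * (symbol ((d ^^ k) p) (s * (i + int k * M)) *
      rescale (q powi (- (s * (i + int k * M))))
        (symbol ((d ^^ (m + n - k)) r) (s * (j + int (m + n - k) * M))))"
  have "symbol ((d ^^ k) p * (d ^^ (m + n - k)) r) (s * (i + j + int (m + n) * M)) =
      symbol ((d ^^ k) p) (s * (i + int k * M)) * rescale (q powi (- (s * (i + int k * M))))
        (symbol ((d ^^ (m + n - k)) r) (s * (j + int (m + n - k) * M)))" if "k \<le> m + n" for k
  proof -
    have sum: "int (m + n) = int k + int (m + n - k)" using that by simp
    have "i + j + int (m + n) * M = (i + int k * M) + (j + int (m + n - k) * M)"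
      by (subst sum) (simp only: distrib_right add_ac)
    then show ?thesis
      using symbol_top_mult[OF s iterate_filtered[OF X Y p, of k] iterate_filtered[OF X Y r, of "m + n - k"]]
      by (simp only:)
  qed
  then have "?lhs = (\<Sum>k\<le>m + n. ?f k)"
    by (simp add: leibniz symbol_sum symbol_of_nat_mult)
  also have "\<dots> = (\<Sum>k\<in>{m}. ?f k)"
  proof (rule sum.mono_neutral_right)
    show "\<forall>k\<in>{..m + n} - {m}. ?f k = 0"
    proof
      fix k assume "k \<in> {..m + n} - {m}"
      then consider "m < k" | "n < m + n - k" by fastforce
      then show "?f k = 0" by cases (simp_all only: m n rescale_0 mult_zero_left mult_zero_right)
    qed
  qed auto
  finally show ?thesis by simp
qed

text \<open>
  As \<open>M \<ge> 1\<close>, the weights \<open>i + nM\<close> eventually leave the bounded range of the orbit, so the order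
  of an element exists as soon as one of its top parts is nonzero.
\<close>

lemma last_top_iterate:
  assumes s: "s * s = 1" and M: "M \<ge> 1" and k: "symbol ((d ^^ k) p) (s * (i + int k * M)) \<noteq> 0"
  obtains m where "k \<le> m" and "symbol ((d ^^ m) p) (s * (i + int m * M)) \<noteq> 0"
    and "\<And>l. m < l \<Longrightarrow> symbol ((d ^^ l) p) (s * (i + int l * M)) = 0"
proof -
  define T where "T = {m. symbol ((d ^^ m) p) (s * (i + int m * M)) \<noteq> 0}"
  obtain N where N: "\<And>n k. int N < \<bar>k\<bar> \<Longrightarrow> symbol ((d ^^ n) p) k = 0"
    using bounded[of p] by blast
  have abs_s: "\<bar>s * x\<bar> = \<bar>x\<bar>" for x
  proof -
    have "s = 1 \<or> s = - 1" using s by (simp add: zmult_eq_1_iff)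
    then show ?thesis by auto
  qed
  have "T \<subseteq> {..N + nat \<bar>i\<bar>}"
  proof
    fix m assume "m \<in> T"
    then have "\<bar>s * (i + int m * M)\<bar> \<le> int N" using N by (fastforce simp: T_def not_less)
    then have "\<bar>i + int m * M\<bar> \<le> int N" by (simp only: abs_s)
    moreover have "int m * 1 \<le> int m * M" using M by (intro mult_left_mono) auto
    ultimately show "m \<in> {..N + nat \<bar>i\<bar>}" by auto
  qed
  then have T: "finite T" by (rule finite_subset) simp
  have kT: "k \<in> T" using k by (simp add: T_def)
  show ?thesis
  proof (rule that[of "Max T"])
    show "k \<le> Max T" using T kT by simp
    have "Max T \<in> T" using T kT by (intro Max_in) auto
    then show "symbol ((d ^^ Max T) p) (s * (i + int (Max T) * M)) \<noteq> 0" by (simp add: T_def)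
    show "symbol ((d ^^ l) p) (s * (i + int l * M)) = 0" if "Max T < l" for l
      using that T by (metis (mono_tags, lifting) Max_ge T_def mem_Collect_eq not_less)
  qed
qed

text \<open>
  The order is additive on products. Characteristic zero enters through the binomial coefficient.
\<close>

lemma top_leibniz_nonzero:
  assumes s: "s * s = 1"
    and X: "d (var GenX) \<in> filtered s (s + M)" and Y: "d (var GenY) \<in> filtered s (- s + M)"
    and p: "p \<in> filtered s i" and r: "r \<in> filtered s j"
    and m: "\<And>k. m < k \<Longrightarrow> symbol ((d ^^ k) p) (s * (i + int k * M)) = 0"
    and n: "\<And>k. n < k \<Longrightarrow> symbol ((d ^^ k) r) (s * (j + int k * M)) = 0"
    and m': "symbol ((d ^^ m) p) (s * (i + int m * M)) \<noteq> 0"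
    and n': "symbol ((d ^^ n) r) (s * (j + int n * M)) \<noteq> 0"
  shows "symbol ((d ^^ (m + n)) (p * r)) (s * (i + j + int (m + n) * M)) \<noteq> 0"
proof -
  have "of_nat ((m + n) choose m) \<noteq> (0 :: 'k poly)" by simp
  moreover have "q powi (- (s * (i + int m * M))) \<noteq> 0" using q_nonzero by simp
  ultimately show ?thesis using m' n'
    by (subst top_leibniz[OF s X Y p r m n]) (simp_all add: rescale_eq_0_iff)
qed

lemma iterate_one: "1 \<le> k \<Longrightarrow> (d ^^ k) 1 = 0"
proof (induction k)
  case (Suc k)
  then show ?case by (cases k) (simp_all add: one zero)
qed simp

text \<open>
  The identity \<open>(q - 1) XY = Z - 1\<close> in the quotient.
\<close>

lemma XY_symbol: "symbol (const (q - 1) * (var GenX * var GenY)) = symbol (commutator_YX - 1)"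
  using q_not_one
  by (auto simp: fun_eq_iff symbol_const_mult symbol_XY symbol_diff symbol_commutator_YX symbol_one
      one_pCons)

text \<open>
  Since \<open>s * s = 1\<close>, the first symbol is the part of \<open>d(X)\<close> that raises the weight by \<open>s k\<close>, and the
  second one that of \<open>d(Y)\<close>. A largest \<open>M\<close> with a nonzero part contradicts additivity of
  the order, as \<open>Z\<close> and hence \<open>XY\<close>, \<open>X\<close> and \<open>Y\<close> have order zero.
\<close>

lemma no_positive_part:
  assumes s: "s * s = 1" and k: "k \<ge> 1"
  shows "symbol (d (var GenX)) (s * (s + int k)) = 0 \<and> symbol (d (var GenY)) (s * (- s + int k)) = 0"
proof (rule ccontr)
  assume contr: "\<not> ?thesis"
  define E where "E = {k. k \<ge> 1 \<and> (symbol (d (var GenX)) (s * (s + int k)) \<noteq> 0 \<or>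
      symbol (d (var GenY)) (s * (- s + int k)) \<noteq> 0)}"
  have ss: "s * (s * x) = x" for x by (simp add: s flip: mult.assoc)
  have s0: "s \<noteq> 0" using s by auto
  have fin: "finite {k :: nat. symbol p (s * (a + int k)) \<noteq> 0}" for p a
    using finite_vimageI[OF finite_symbol[of p], of "\<lambda>k :: nat. s * (a + int k)"] s0
    by (simp add: vimage_def inj_on_def)
  have E: "finite E"
    by (rule finite_subset[OF _ finite_UnI[OF fin[of "d (var GenX)" s] fin[of "d (var GenY)" "- s"]]])
      (auto simp: E_def)
  have kE: "k \<in> E" using contr k by (auto simp: E_def)
  define M where "M = int (Max E)"
  have "Max E \<in> E" using E kE by (intro Max_in) auto
  then have M: "M \<ge> 1" and top: "symbol (d (var GenX)) (s * (s + M)) \<noteq> 0 \<or>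
      symbol (d (var GenY)) (s * (- s + M)) \<noteq> 0"
    by (auto simp: E_def M_def)
  have notE: "n \<notin> E" if "M < int n" for n using that Max_ge[OF E, of n] by (auto simp: M_def)
  have fil: "d (var g) \<in> filtered s (a + M)" if ga: "(g, a) \<in> {(GenX, s), (GenY, - s)}" for g a
    unfolding filtered_def
  proof (intro CollectI ballI, rule ccontr)
    fix w assume w: "w \<in> Poly_Mapping.keys (d (var g))" and "\<not> s * weight w \<le> a + M"
    then have n: "M < int (nat (s * weight w - a))" "s * weight w = a + int (nat (s * weight w - a))"
      using M by auto
    have "symbol (d (var g)) (s * (s * weight w)) \<noteq> 0" using reduced[OF w] by (simp add: ss)
    then have "nat (s * weight w - a) \<in> E"
      using ga n M by (auto simp: E_def)
    then show False using notE n(1) by blast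
  qed
  have X: "d (var GenX) \<in> filtered s (s + M)" and Y: "d (var GenY) \<in> filtered s (- s + M)"
    using fil[of GenX s] fil[of GenY "- s"] by simp_all
  let ?Z = commutator_YX
  have Zf: "?Z \<in> filtered s 0"
  proof -
    have "?Z = var GenY * var GenX + const (- 1) * (var GenX * var GenY)"
      by (simp add: commutator_YX_def const_def single_uminus)
    moreover have "\<dots> \<in> filtered s 0"
      using filtered_mult[OF filtered_var(2)[of s] filtered_var(1)[of s]]
        filtered_mult[OF filtered_const filtered_mult[OF filtered_var(1)[of s] filtered_var(2)[of s]]]
      by (intro filtered_add) simp_all
    ultimately show ?thesis by simp
  qed
  have dZf: "d ?Z \<in> filtered s M"
    using filtered_derivation[OF free_alg_derivation_axioms X Y Zf] by simp
  \<comment> \<open>Otherwise the order \<open>m\<close> of \<open>Z\<close> is at least 1 and that of \<open>Zb = d(Z)\<close> is \<open>m - 1\<close>,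
    whereas additivity makes it at least \<open>m\<close>.\<close>
  have dZ_top: "symbol (d ?Z) (s * M) = 0"
  proof (rule ccontr)
    assume top_nonzero: "symbol (d ?Z) (s * M) \<noteq> 0"
    obtain b' where b': "symbol (d ?Z) = symbol (?Z * b')" using derivation_commutator_YX by blast
    obtain b where b: "symbol b = symbol b'" "\<And>w. w \<in> Poly_Mapping.keys b \<Longrightarrow> symbol b' (weight w) \<noteq> 0"
      using reduced_representative[of b'] by blast
    have dZb: "symbol (d ?Z) = symbol (?Z * b)"
      by (rule ext) (simp only: b' symbol_commutator_YX_mult b)
    have bf: "b \<in> filtered s M"
      unfolding filtered_def
    proof (intro CollectI ballI, rule ccontr)
      fix w assume "w \<in> Poly_Mapping.keys b" and "\<not> s * weight w \<le> M"
      then have "symbol b (weight w) \<noteq> 0" "symbol (d ?Z) (weight w) = 0"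
        using b symbol_filtered[OF dZf] by auto
      then show False by (simp add: dZb symbol_commutator_YX_mult)
    qed
    have "symbol ((d ^^ 1) ?Z) (s * (0 + int 1 * M)) \<noteq> 0" using top_nonzero by simp
    then obtain m where m: "symbol ((d ^^ m) ?Z) (s * (0 + int m * M)) \<noteq> 0"
      "\<And>l. m < l \<Longrightarrow> symbol ((d ^^ l) ?Z) (s * (0 + int l * M)) = 0"
      using last_top_iterate[OF s M] by metis
    have "symbol ((d ^^ 0) b) (s * (M + int 0 * M)) \<noteq> 0"
      using top_nonzero by (simp add: dZb symbol_commutator_YX_mult)
    then obtain n where n: "symbol ((d ^^ n) b) (s * (M + int n * M)) \<noteq> 0"
      "\<And>l. n < l \<Longrightarrow> symbol ((d ^^ l) b) (s * (M + int l * M)) = 0"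
      using last_top_iterate[OF s M] by metis
    have "symbol ((d ^^ (m + n)) (?Z * b)) (s * (0 + M + int (m + n) * M)) \<noteq> 0"
      by (rule top_leibniz_nonzero[OF s X Y Zf bf m(2) n(2) m(1) n(1)])
    also have "symbol ((d ^^ (m + n)) (?Z * b)) = symbol ((d ^^ Suc (m + n)) ?Z)"
      using iterate_respects[OF dZb, of "m + n"] by (simp add: funpow_swap1)
    also have "s * (0 + M + int (m + n) * M) = s * (0 + int (Suc (m + n)) * M)"
      by (simp add: algebra_simps)
    finally show False using m(2)[of "Suc (m + n)"] by simp
  qed
  \<comment> \<open>A representative of \<open>d(Z)\<close> of weight at most \<open>M - 1\<close> stays below the top weight forever.\<close>
  have Z_top: "symbol ((d ^^ l) ?Z) (s * (int l * M)) = 0" if l1: "1 \<le> l" for l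
  proof -
    obtain l' where l: "l = Suc l'" using l1 by (cases l) auto
    obtain r where r: "symbol r = symbol (d ?Z)"
      "\<And>w. w \<in> Poly_Mapping.keys r \<Longrightarrow> symbol (d ?Z) (weight w) \<noteq> 0"
      using reduced_representative[of "d ?Z"] by blast
    have "r \<in> filtered s (M - 1)"
      unfolding filtered_def
    proof (intro CollectI ballI, rule ccontr)
      fix w assume w: "w \<in> Poly_Mapping.keys r" and "\<not> s * weight w \<le> M - 1"
      then consider "M < s * weight w" | "s * weight w = M" by linarith
      then show False
      proof cases
        case 1
        then show ?thesis using symbol_filtered[OF dZf] r(2)[OF w] by simp
      next
        case 2
        then have "weight w = s * M" using ss[of "weight w"] by simp
        then show ?thesis using dZ_top r(2)[OF w] by simp
      qed
    qed
    from iterate_filtered[OF X Y this, of l'] have "symbol ((d ^^ l') r) (s * (int l * M)) = 0"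
      by (rule symbol_filtered) (simp add: l ss s algebra_simps)
    moreover have "symbol ((d ^^ l') r) = symbol ((d ^^ l) ?Z)"
      using iterate_respects[OF r(1), of l'] by (simp add: l funpow_swap1)
    ultimately show ?thesis by simp
  qed
  have XY_top: "symbol ((d ^^ l) (var GenX * var GenY)) (s * (int l * M)) = 0" if l: "1 \<le> l" for l
  proof -
    have "symbol ((d ^^ l) (const (q - 1) * (var GenX * var GenY))) =
        symbol ((d ^^ l) (commutator_YX - 1))"
      by (rule iterate_respects) (rule XY_symbol)
    then have "smult (q - 1) (symbol ((d ^^ l) (var GenX * var GenY)) (s * (int l * M))) = 0"
      using Z_top[OF l]
      by (simp add: iterate_const_mult iterate_diff iterate_one[OF l] symbol_const_mult symbol_diff
          symbol_zero fun_eq_iff)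
    then show ?thesis using q_not_one by simp
  qed
  have "symbol ((d ^^ 0) (var GenX)) (s * (s + int 0 * M)) \<noteq> 0" using s by (simp add: symbol_var)
  then obtain m where m: "symbol ((d ^^ m) (var GenX)) (s * (s + int m * M)) \<noteq> 0"
    "\<And>l. m < l \<Longrightarrow> symbol ((d ^^ l) (var GenX)) (s * (s + int l * M)) = 0"
    using last_top_iterate[OF s M] by metis
  have "symbol ((d ^^ 0) (var GenY)) (s * (- s + int 0 * M)) \<noteq> 0"
    using s q_not_one by (simp add: symbol_var)
  then obtain n where n: "symbol ((d ^^ n) (var GenY)) (s * (- s + int n * M)) \<noteq> 0"
    "\<And>l. n < l \<Longrightarrow> symbol ((d ^^ l) (var GenY)) (s * (- s + int l * M)) = 0"
    using last_top_iterate[OF s M] by metis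
  have "symbol ((d ^^ (m + n)) (var GenX * var GenY)) (s * (s + - s + int (m + n) * M)) \<noteq> 0"
    by (rule top_leibniz_nonzero[OF s X Y filtered_var(1) filtered_var(2) m(2) n(2) m(1) n(1)])
  then have "m = 0" "n = 0" using XY_top[of "m + n"] by force+
  then show False using m(2)[of 1] n(2)[of 1] top by simp
qed


section \<open>Weight-preserving locally finite derivations\<close>

lemma symbol_derivation_var:
  "n \<noteq> 1 \<Longrightarrow> symbol (d (var GenX)) n = 0" "n \<noteq> - 1 \<Longrightarrow> symbol (d (var GenY)) n = 0"
proof -
  show "symbol (d (var GenX)) n = 0" if "n \<noteq> 1"
    using that no_positive_part[of 1 "nat (n - 1)"] no_positive_part[of "- 1" "nat (1 - n)"]
    by (cases "n > 1") (simp_all add: algebra_simps)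
  show "symbol (d (var GenY)) n = 0" if "n \<noteq> - 1"
    using that no_positive_part[of 1 "nat (n + 1)"] no_positive_part[of "- 1" "nat (- n - 1)"]
    by (cases "n > - 1") (simp_all add: algebra_simps)
qed

text \<open>
  The polynomial \<open>S\<close> with \<open>d(Z) = S(Z)\<close>.
\<close>

definition Z_derivative :: "'k poly" where
  "Z_derivative = symbol (d commutator_YX) 0"

text \<open>
  With \<open>d(X) = f(Z) X\<close> and \<open>d(Y) = g(Z) X\<^sup>-\<^sup>1\<close>, this is \<open>d((q - 1) XY)\<close> expanded by the Leibniz rule.
\<close>

lemma Z_derivative_altdef:
  "Z_derivative = symbol (d (var GenX)) 1 * [:- 1, 1:] +
    smult (q - 1) (rescale (inverse q) (symbol (d (var GenY)) (- 1)))"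
  and symbol_derivation_commutator_YX: "m \<noteq> 0 \<Longrightarrow> symbol (d commutator_YX) m = 0"
proof -
  have X: "symbol (d (var GenX) * r) m = symbol (d (var GenX)) 1 * rescale (inverse q) (symbol r (m - 1))"
    for r m
    unfolding symbol_mult
    by (subst twisted_mult_single[of 1]) (simp_all add: symbol_derivation_var power_int_minus)
  have "symbol (d (const (q - 1) * (var GenX * var GenY))) = symbol (d (commutator_YX - 1))"
    by (rule respects) (rule XY_symbol)
  then have Z: "symbol (d commutator_YX) m =
      smult (q - 1) (symbol (d (var GenX) * var GenY) m + symbol (var GenX * d (var GenY)) m)" for m
    by (simp add: fun_eq_iff const_mult symbol_const_mult diff one mult symbol_add symbol_diff const symbol_zero)
  show "symbol (d commutator_YX) m = 0" if "m \<noteq> 0"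
    using that by (simp add: Z X symbol_var_mult symbol_var symbol_derivation_var)
  have "(q - 1) * (inverse q * (inverse (q - 1) * q)) = (q - 1) * inverse (q - 1) * (inverse q * q)"
    by (simp only: mult_ac)
  also have "\<dots> = 1" using q_nonzero q_not_one by simp
  finally have unit: "(q - 1) * (inverse q * (inverse (q - 1) * q)) = 1" .
  show "Z_derivative = symbol (d (var GenX)) 1 * [:- 1, 1:] +
    smult (q - 1) (rescale (inverse q) (symbol (d (var GenY)) (- 1)))"
    using q_nonzero q_not_one
    by (simp add: Z_derivative_def Z X unit symbol_var_mult symbol_var rescale_smult rescale_pCons smult_add_right
        smult_diff_right)
qed

text \<open>
  By \<open>symbol_negative_vanishes\<close>, \<open>g(1/q) = 0\<close>.
\<close>

lemma Z_derivative_at_1: "poly Z_derivative 1 = 0"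
  using symbol_negative_vanishes[of "- 1" "d (var GenY)"]
  by (simp add: Z_derivative_altdef poly_rescale power_int_minus)

lemma Z_derivative_at_0: "poly Z_derivative 0 = 0"
  using derivation_commutator_YX by (auto simp: Z_derivative_def symbol_commutator_YX_mult)

text \<open>
  By Horner's scheme in \<open>Z\<close>, every polynomial is the symbol of an element for which the formula can be
  computed. Since \<open>d\<close> respects symbols, the formula holds for any \<open>r\<close> with that symbol.
\<close>

lemma chain_rule:
  assumes "\<And>m. symbol r m = (if m = 0 then R else 0)"
  shows "symbol (d r) m = (if m = 0 then pderiv R * Z_derivative else 0)"
proof -
  have "\<exists>r. (\<forall>m. symbol r m = (if m = 0 then R else 0)) \<and>
      (\<forall>m. symbol (d r) m = (if m = 0 then pderiv R * Z_derivative else 0))"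
  proof (induction R)
    case 0
    show ?case by (rule exI[of _ 0]) (simp add: symbol_zero zero)
  next
    case (pCons c R)
    then obtain r where r: "\<And>m. symbol r m = (if m = 0 then R else 0)"
      "\<And>m. symbol (d r) m = (if m = 0 then pderiv R * Z_derivative else 0)" by blast
    have dZ: "symbol (d commutator_YX * r) m = (if m = 0 then Z_derivative * R else 0)" for m
      unfolding symbol_mult
      by (subst twisted_mult_single[of 0])
        (simp_all add: symbol_derivation_commutator_YX r flip: Z_derivative_def)
    show ?case
      by (rule exI[of _ "const c + commutator_YX * r"])
        (auto simp: symbol_add symbol_const symbol_commutator_YX_mult r add const mult symbol_zero
          dZ pderiv_pCons algebra_simps)
  qed
  then obtain r' where r': "\<And>m. symbol r' m = (if m = 0 then R else 0)"
    "\<And>m. symbol (d r') m = (if m = 0 then pderiv R * Z_derivative else 0)" by blast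
  have "symbol r = symbol r'" by (rule ext) (simp add: assms r'(1))
  from respects[OF this] show ?thesis by (simp add: r'(2))
qed

text \<open>
  If \<open>S\<close> has degree at least 2, then \<open>R \<mapsto> R' S\<close> strictly raises the degree of nonconstant
  polynomials, and the degrees of \<open>d\<^sup>n(Z)\<close> are unbounded.
\<close>

lemma degree_Z_derivative_le: "Polynomial.degree Z_derivative \<le> 1"
proof (rule ccontr)
  assume "\<not> Polynomial.degree Z_derivative \<le> 1"
  then have deg: "Polynomial.degree Z_derivative \<ge> 2" by simp
  have "\<exists>R. (\<forall>m. symbol ((d ^^ n) commutator_YX) m = (if m = 0 then R else 0)) \<and>
      Polynomial.degree R \<ge> n + 1" for n
  proof (induction n)
    case 0
    show ?case by (rule exI[of _ "[:0, 1:]"]) (simp add: symbol_commutator_YX)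
  next
    case (Suc n)
    then obtain R where R: "\<And>m. symbol ((d ^^ n) commutator_YX) m = (if m = 0 then R else 0)"
      "Polynomial.degree R \<ge> n + 1" by blast
    have "pderiv R \<noteq> 0" using R(2) by (simp add: pderiv_eq_0_iff)
    moreover have "Z_derivative \<noteq> 0" using deg by auto
    ultimately have "Polynomial.degree (pderiv R * Z_derivative) = Polynomial.degree R - 1 + Polynomial.degree Z_derivative"
      by (simp add: degree_mult_eq degree_pderiv)
    then have "Polynomial.degree (pderiv R * Z_derivative) \<ge> Suc n + 1" using R(2) deg by simp
    then show ?case using chain_rule[OF R(1)] by (auto intro: exI[of _ "pderiv R * Z_derivative"])
  qed
  moreover obtain N where N: "\<And>n k. Polynomial.degree (symbol ((d ^^ n) commutator_YX) k) \<le> N"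
    using bounded[of commutator_YX] by blast
  ultimately show False by (metis N[of N 0] Suc_eq_plus1 not_less_eq_eq)
qed

lemma Z_derivative_zero: "Z_derivative = 0"
proof (rule ccontr)
  assume nonzero: "Z_derivative \<noteq> 0"
  have "card {0, 1 :: 'k} \<le> card {x. poly Z_derivative x = 0}"
    using Z_derivative_at_0 Z_derivative_at_1 poly_roots_finite[OF nonzero] by (intro card_mono) auto
  then show False using card_poly_roots_bound[OF nonzero] degree_Z_derivative_le by simp
qed

lemma derivation_weight_zero:
  assumes "\<And>m. m \<noteq> 0 \<Longrightarrow> symbol r m = 0"
  shows "symbol (d r) m = 0"
proof -
  have "symbol r m = (if m = 0 then symbol r 0 else 0)" for m using assms by simp
  from chain_rule[OF this] show ?thesis by (simp add: Z_derivative_zero)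
qed

lemma weight_zero_representative: "\<exists>r. \<forall>m. symbol r m = (if m = 0 then R else 0)"
proof (induction R)
  case 0
  show ?case by (rule exI[of _ 0]) (simp add: symbol_zero)
next
  case (pCons c R)
  then obtain r where "\<And>m. symbol r m = (if m = 0 then R else 0)" by blast
  then show ?case
    by (intro exI[of _ "const c + commutator_YX * r"])
      (simp add: symbol_add symbol_const symbol_commutator_YX_mult)
qed

text \<open>
  As \<open>d\<close> kills \<open>k[Z]\<close>, \<open>d\<^sup>n(X) = f(Z)\<^sup>n X\<close>, whose degree in \<open>Z\<close> is \<open>n\<close> times that of \<open>f\<close>.
\<close>

lemma derivation_X_scalar: "\<exists>c. \<forall>m. symbol (d (var GenX)) m = symbol (const c * var GenX) m"
proof -
  define f where "f = symbol (d (var GenX)) 1"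
  obtain r where r: "\<And>m. symbol r m = (if m = 0 then f else 0)"
    using weight_zero_representative by blast
  have mult_r: "symbol (r * p) m = f * symbol p m" for p m
    unfolding symbol_mult by (subst twisted_mult_single[of 0]) (simp_all add: r)
  have r_power: "symbol (r ^ n) m = (if m = 0 then f ^ n else 0)" for n m
    by (induction n) (simp_all add: symbol_one mult_r)
  have mult_r_power: "symbol (r ^ n * p) m = f ^ n * symbol p m" for n p m
    by (induction n) (simp_all add: mult_r mult.assoc)
  have dX: "symbol (d (var GenX)) m = symbol (r * var GenX) m" for m
    by (simp add: mult_r symbol_var symbol_derivation_var f_def)
  have iterate: "symbol ((d ^^ n) (var GenX)) = symbol (r ^ n * var GenX)" for n
  proof (induction n)
    case (Suc n)
    have "symbol (d (r ^ n) * var GenX) m = 0" for m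
      using derivation_weight_zero[of "r ^ n"]
      by (simp add: symbol_mult twisted_mult_def r_power)
    then show ?case
      using respects[OF Suc]
      by (simp add: fun_eq_iff mult symbol_add mult_r_power dX mult.assoc mult_r algebra_simps)
  qed simp
  obtain N where N: "\<And>n k. Polynomial.degree (symbol ((d ^^ n) (var GenX)) k) \<le> N"
    using bounded[of "var GenX"] by blast
  have "Polynomial.degree f = 0"
  proof (rule ccontr)
    assume deg: "Polynomial.degree f \<noteq> 0"
    then have "f \<noteq> 0" by auto
    then have "Polynomial.degree (symbol ((d ^^ Suc N) (var GenX)) 1) = Suc N * Polynomial.degree f"
      by (simp add: iterate mult_r_power symbol_var degree_power_eq del: power_Suc funpow.simps)
    moreover have "Suc N * 1 \<le> Suc N * Polynomial.degree f"
      using deg by (intro mult_le_mono) auto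
    ultimately show False
      using N[of "Suc N" 1] by (metis Suc_n_not_le_n mult_1_right order_trans)
  qed
  then obtain c where "f = [:c:]" by (metis degree_eq_zeroE)
  then show ?thesis
    by (intro exI[of _ c]) (simp add: dX mult_r symbol_const_mult)
qed

text \<open>
  With \<open>f = c\<close>, the equation \<open>S = 0\<close> determines \<open>d(Y)\<close> through \<open>Z_derivative_altdef\<close>.
\<close>

theorem scalar_on_generators:
  "\<exists>c. symbol (d (var GenX)) = symbol (const c * var GenX) \<and>
    symbol (d (var GenY)) = symbol (const (- c) * var GenY)"
proof -
  obtain c where X: "\<And>m. symbol (d (var GenX)) m = symbol (const c * var GenX) m"
    using derivation_X_scalar by blast
  let ?g = "symbol (d (var GenY)) (- 1)"
  have "smult (q - 1) (rescale (inverse q) ?g) = [:c, - c:]"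
    using Z_derivative_zero X by (simp add: Z_derivative_altdef symbol_const_mult symbol_var add_eq_0_iff)
  then have "smult (inverse (q - 1)) (rescale q (smult (q - 1) (rescale (inverse q) ?g))) =
      smult (inverse (q - 1)) (rescale q [:c, - c:])" by simp
  then have "?g = smult (inverse (q - 1)) (rescale q [:c, - c:])"
    using q_nonzero q_not_one by (simp add: rescale_smult rescale_rescale)
  then have "symbol (d (var GenY)) m = symbol (const (- c) * var GenY) m" for m
    by (cases "m = - 1") (simp_all add: symbol_const_mult symbol_var symbol_derivation_var rescale_pCons
        mult.commute mult.left_commute)
  with X show ?thesis by (auto intro!: exI[of _ c])
qed

end

section \<open>Local finiteness in the quotient algebra\<close>

lemma qweyl_submodule_closed:
  assumes V: "submodule V (ring_of_type_algebra :: 'k::field ring) (qweyl q)"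
  shows "qweyl_class q 0 \<in> V"
    and "qweyl_class q p \<in> V \<Longrightarrow> qweyl_class q r \<in> V \<Longrightarrow> qweyl_class q (p + r) \<in> V"
    and "qweyl_class q p \<in> V \<Longrightarrow> qweyl_class q (const c * p) \<in> V"
proof -
  interpret submodule V "ring_of_type_algebra :: 'k ring" "qweyl q" by (rule V)
  show "qweyl_class q 0 \<in> V"
    using subgroup.one_closed[OF subgroup_axioms] by (simp flip: qweyl_zero)
  show "qweyl_class q (p + r) \<in> V" if "qweyl_class q p \<in> V" "qweyl_class q r \<in> V"
    using subgroup.m_closed[OF subgroup_axioms that] by (simp add: qweyl_add)
  show "qweyl_class q (const c * p) \<in> V" if "qweyl_class q p \<in> V"
    using smult_closed[OF _ that, of c] by (simp add: qweyl_smult ring_of_type_algebra_def)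
qed

lemma qweyl_submodule_sum:
  assumes V: "submodule V (ring_of_type_algebra :: 'k::field ring) (qweyl q)"
    and "\<And>i. i \<in> W \<Longrightarrow> qweyl_class q (f i) \<in> V"
  shows "qweyl_class q (sum f W) \<in> V"
  using assms(2)
  by (induction W rule: infinite_finite_induct) (auto intro: qweyl_submodule_closed[OF V])

lemma lin_span_superset: "S \<subseteq> lin_span A S"
  by (auto simp: lin_span_def)

lemma lin_span_minimal: "submodule V ring_of_type_algebra A \<Longrightarrow> S \<subseteq> V \<Longrightarrow> lin_span A S \<subseteq> V"
  by (auto simp: lin_span_def)

lemma derivation_qweyl_iterate_zero:
  assumes D: "D \<in> derivations (qweyl q)"
  shows "(D ^^ n) \<zero>\<^bsub>qweyl q\<^esub> = \<zero>\<^bsub>qweyl q\<^esub>"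
  using derivation_qweyl_const[OF D, of 0]
  by (induction n) (simp_all add: qweyl_zero const_def)

text \<open>
  The orbits of a locally nilpotent derivation are finite sets.
\<close>

lemma locally_nilpotent_imp_locally_finite:
  assumes D: "D \<in> derivations (qweyl q)" and nil: "locally_nilpotent (qweyl q) D"
  shows "locally_finite (qweyl q) D"
  unfolding locally_finite_def
proof
  fix a assume a: "a \<in> carrier (qweyl q)"
  let ?O = "{(D ^^ n) a | n. n \<ge> 0}"
  obtain m where m: "(D ^^ m) a = \<zero>\<^bsub>qweyl q\<^esub>"
    using nil a by (auto simp: locally_nilpotent_def)
  have "(D ^^ n) a \<in> (\<lambda>n. (D ^^ n) a) ` {..m}" for n
  proof (cases "n \<le> m")
    case False
    then have "(D ^^ n) a = (D ^^ (n - m)) ((D ^^ m) a)"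
      by (simp flip: funpow_add comp_apply[of "D ^^ _"])
    then have "(D ^^ n) a = (D ^^ m) a" by (simp add: m derivation_qweyl_iterate_zero[OF D])
    then show ?thesis by auto
  qed auto
  then have "?O \<subseteq> (\<lambda>n. (D ^^ n) a) ` {..m}" by auto
  then have "finite ?O" by (rule finite_subset) simp
  moreover have "(D ^^ n) a \<in> carrier (qweyl q)" for n
    by (induction n) (use a D in \<open>auto simp: derivations_def\<close>)
  then have "?O \<subseteq> carrier (qweyl q)" by auto
  ultimately show "finite_dim (qweyl q) (lin_span (qweyl q) ?O)"
    by (auto simp: finite_dim_def)
qed

context quantum_weyl begin

text \<open>
  The elements whose symbols have support and degrees bounded by \<open>N\<close> form a subspace \<open>U N\<close>. These
  subspaces exhaust the algebra, so one of them contains a given finite spanning set.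
\<close>

lemma finite_dim_orbit_bounded:
  assumes lift: "\<And>p. D (qweyl_class q p) = qweyl_class q (d p)"
    and fin: "finite_dim (qweyl q) (lin_span (qweyl q) {(D ^^ n) (qweyl_class q p) | n. n \<ge> 0})"
  shows "\<exists>N. \<forall>n k. (int N < \<bar>k\<bar> \<longrightarrow> symbol ((d ^^ n) p) k = 0) \<and>
    Polynomial.degree (symbol ((d ^^ n) p) k) \<le> N"
proof -
  define bnd where "bnd N r \<longleftrightarrow>
      (\<forall>k. (int N < \<bar>k\<bar> \<longrightarrow> symbol r k = 0) \<and> Polynomial.degree (symbol r k) \<le> N)" for N r
  define U where "U N = {qweyl_class q r | r. bnd N r}" for N
  have U: "submodule (U N) ring_of_type_algebra (qweyl q)" for N
  proof (rule module.submoduleI[OF module_qweyl])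
    show "U N \<subseteq> carrier (qweyl q)" using qweyl_class_carrier by (auto simp: U_def)
    show "\<zero>\<^bsub>qweyl q\<^esub> \<in> U N"
      by (auto simp: U_def bnd_def qweyl_zero symbol_zero intro!: exI[of _ 0])
    show "\<ominus>\<^bsub>qweyl q\<^esub> a \<in> U N" if "a \<in> U N" for a
      using that by (fastforce simp: U_def bnd_def qweyl_uminus symbol_uminus)
    show "a \<oplus>\<^bsub>qweyl q\<^esub> b \<in> U N" if ab: "a \<in> U N" "b \<in> U N" for a b
    proof -
      obtain r t where "a = qweyl_class q r" "bnd N r" "b = qweyl_class q t" "bnd N t"
        using ab by (auto simp: U_def)
      then show ?thesis
        unfolding U_def by (auto simp: bnd_def qweyl_add symbol_add degree_add_le intro!: exI[of _ "r + t"])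
    qed
    show "c \<odot>\<^bsub>qweyl q\<^esub> a \<in> U N" if a: "a \<in> U N" for c a
    proof -
      obtain r where "a = qweyl_class q r" "bnd N r" using a by (auto simp: U_def)
      then show ?thesis
        unfolding U_def
        by (auto simp: bnd_def qweyl_smult symbol_const_mult intro!: exI[of _ "const c * r"])
    qed
  qed
  have bnd_mono: "bnd N r \<Longrightarrow> N \<le> M \<Longrightarrow> bnd M r" for N M r
    unfolding bnd_def by (meson le_trans of_nat_le_iff order_le_less_trans)
  have bnd_ex: "\<exists>N. bnd N r" for r
  proof -
    define S where "S = (\<Sum>k | symbol r k \<noteq> 0. nat \<bar>k\<bar> + Polynomial.degree (symbol r k))"
    have le: "nat \<bar>k\<bar> + Polynomial.degree (symbol r k) \<le> S" if "symbol r k \<noteq> 0" for k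
      unfolding S_def by (rule member_le_sum) (use that in \<open>auto simp: finite_symbol\<close>)
    have "bnd S r"
      unfolding bnd_def
    proof (intro allI conjI impI)
      show "symbol r k = 0" if "int S < \<bar>k\<bar>" for k
        by (rule ccontr) (use le[of k] that in simp)
      show "Polynomial.degree (symbol r k) \<le> S" for k
        by (cases "symbol r k = 0") (use le[of k] in simp_all)
    qed
    then show ?thesis by blast
  qed
  obtain B where B: "finite B" "B \<subseteq> carrier (qweyl q)"
    "lin_span (qweyl q) {(D ^^ n) (qweyl_class q p) | n. n \<ge> 0} = lin_span (qweyl q) B"
    using fin by (auto simp: finite_dim_def)
  have "\<forall>b\<in>B. \<exists>N. b \<in> U N"
    using B(2) bnd_ex unfolding U_def carrier_qweyl by blast
  then obtain h where h: "\<And>b. b \<in> B \<Longrightarrow> b \<in> U (h b)" by metis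
  define N where "N = sum h B"
  have "B \<subseteq> U N"
  proof
    fix b assume b: "b \<in> B"
    then have "h b \<le> N" unfolding N_def by (intro member_le_sum) (auto simp: B(1))
    then show "b \<in> U N" using h[OF b] bnd_mono unfolding U_def by blast
  qed
  then have sub: "lin_span (qweyl q) {(D ^^ n) (qweyl_class q p) | n. n \<ge> 0} \<subseteq> U N"
    unfolding B(3) by (rule lin_span_minimal[OF U])
  have "bnd N ((d ^^ n) p)" for n
  proof -
    have "(D ^^ n) (qweyl_class q p) \<in> U N"
      using sub lin_span_superset[of "{(D ^^ n) (qweyl_class q p) | n. n \<ge> 0}" "qweyl q"] by blast
    then obtain r where "qweyl_class q ((d ^^ n) p) = qweyl_class q r" "bnd N r"
      by (auto simp: U_def iterate_qweyl_lift[of D q d, OF lift])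
    then show ?thesis by (simp add: bnd_def qweyl_class_eq_iff)
  qed
  then show ?thesis unfolding bnd_def by blast
qed

lemma qweyl_H:
  "qweyl_H q \<in> derivations (qweyl q)"
  "qweyl_H q (qweyl_class q p) = qweyl_class q (free_H p)"
proof -
  have H: "qweyl_H q \<in> derivations (qweyl q) \<and> qweyl_H q (qweyl_X q) = qweyl_X q \<and>
      qweyl_H q (qweyl_Y q) = \<ominus>\<^bsub>qweyl q\<^esub> qweyl_Y q"
    unfolding qweyl_H_def by (rule theI'[OF qweyl_H_ex1])
  then show D: "qweyl_H q \<in> derivations (qweyl q)" by blast
  show "qweyl_H q (qweyl_class q p) = qweyl_class q (free_H p)"
  proof (rule derivation_qweyl_lift[OF D])
    show "free_alg_derivation free_H"
      by standard (simp_all add: free_H_add free_H_const free_H_mult)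
    show "qweyl_H q (qweyl_class q (var g)) = qweyl_class q (free_H (var g))" for g
      using H by (cases g) (simp_all add: qweyl_X_def qweyl_Y_def qweyl_uminus free_H_var)
  qed
qed

lemma scale_qweyl_H:
  "scale_map (qweyl q) c (qweyl_H q) (qweyl_class q p) = qweyl_class q (const c * free_H p)"
  by (simp add: scale_map_def qweyl_class_carrier qweyl_H qweyl_smult)

lemma scale_qweyl_H_derivation: "scale_map (qweyl q) c (qweyl_H q) \<in> derivations (qweyl q)"
proof -
  have comm: "x * (const c * y) = const c * (x * y)" for x y :: "(generator, 'k) free_alg"
    by (metis const_commute mult.assoc)
  have "scale_map (qweyl q) c (qweyl_H q) \<in> carrier (qweyl q) \<rightarrow>\<^sub>E carrier (qweyl q)"
    unfolding scale_map_def
    by (auto simp: restrict_PiE_iff carrier_qweyl qweyl_H qweyl_smult)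
  then show ?thesis
    by (auto simp: derivations_def carrier_qweyl scale_qweyl_H qweyl_add qweyl_mult qweyl_smult
        free_H_add free_H_mult free_H_const comm distrib_left mult.assoc)
qed

lemma locally_finite_imp_scale_H:
  assumes D: "D \<in> derivations (qweyl q)" and lf: "locally_finite (qweyl q) D"
  shows "\<exists>c. D = scale_map (qweyl q) c (qweyl_H q)"
proof -
  have "\<exists>r. D (qweyl_class q (var g)) = qweyl_class q r \<and>
      (\<forall>w\<in>Poly_Mapping.keys r. symbol r (weight w) \<noteq> 0)" for g
  proof -
    obtain p where p: "D (qweyl_class q (var g)) = qweyl_class q p"
      using derivation_qweyl_carrier[OF D] by (auto simp: carrier_qweyl)
    obtain r where "symbol r = symbol p" "\<And>w. w \<in> Poly_Mapping.keys r \<Longrightarrow> symbol p (weight w) \<noteq> 0"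
      using reduced_representative by blast
    then show ?thesis using p by (intro exI[of _ r]) (simp add: qweyl_class_eq_iff)
  qed
  then obtain v where v: "\<And>g. D (qweyl_class q (var g)) = qweyl_class q (v g)"
    "\<And>g w. w \<in> Poly_Mapping.keys (v g) \<Longrightarrow> symbol (v g) (weight w) \<noteq> 0" by metis
  let ?d = "free_derivation v"
  have lift: "D (qweyl_class q p) = qweyl_class q (?d p)" for p
    by (rule derivation_qweyl_lift[OF D free_alg_derivation_free_derivation])
      (simp add: v free_derivation_var)
  interpret free_alg_derivation ?d by (rule free_alg_derivation_free_derivation)
  interpret locally_finite_lift q ?d
  proof
    show "symbol (?d p) = symbol (?d r)" if "symbol p = symbol r" for p r
      using that lift[of p] lift[of r] by (simp flip: qweyl_class_eq_iff)
    show "\<exists>N. \<forall>n k. (int N < \<bar>k\<bar> \<longrightarrow> symbol ((?d ^^ n) p) k = 0) \<and>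
        Polynomial.degree (symbol ((?d ^^ n) p) k) \<le> N" for p
      by (rule finite_dim_orbit_bounded[of D, OF lift])
        (use lf qweyl_class_carrier[of q p] in \<open>simp add: locally_finite_def\<close>)
    show "symbol (?d (var g)) (weight w) \<noteq> 0" if "w \<in> Poly_Mapping.keys (?d (var g))" for g w
      using that v(2) by (simp add: free_derivation_var)
  qed
  obtain c where c: "symbol (?d (var GenX)) = symbol (const c * var GenX)"
    "symbol (?d (var GenY)) = symbol (const (- c) * var GenY)"
    using scalar_on_generators by blast
  have "D = scale_map (qweyl q) c (qweyl_H q)"
  proof (rule derivation_qweyl_unique[OF D scale_qweyl_H_derivation])
    show "D (qweyl_X q) = scale_map (qweyl q) c (qweyl_H q) (qweyl_X q)"
      using c(1) by (simp add: qweyl_X_def lift scale_qweyl_H free_H_var qweyl_class_eq_iff)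
    show "D (qweyl_Y q) = scale_map (qweyl q) c (qweyl_H q) (qweyl_Y q)"
      using c(2) by (simp add: qweyl_Y_def lift scale_qweyl_H free_H_var qweyl_class_eq_iff const_def
          single_uminus)
  qed
  then show ?thesis by blast
qed

lemma lookup_const_mult: "Poly_Mapping.lookup (const c * p) w = c * Poly_Mapping.lookup p w"
  for p :: "('g, 'k) free_alg"
proof (induction p rule: free_alg_induct)
  case (single u e)
  show ?case by (simp add: const_def mult_single lookup_single when_def)
qed (simp add: distrib_left lookup_add)

text \<open>
  The words in \<open>p\<close> are eigenvectors, so the product \<open>chi\<close> of the linear factors of their eigenvalues
  annihilates the orbit of \<open>p\<close>. As \<open>chi\<close> is monic, the iterates below its degree span the orbit.
\<close>

lemma scale_H_locally_finite: "locally_finite (qweyl q) (scale_map (qweyl q) c (qweyl_H q))"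
  unfolding locally_finite_def
proof
  fix a assume "a \<in> carrier (qweyl q)"
  then obtain p where a: "a = qweyl_class q p" by (auto simp: carrier_qweyl)
  let ?D = "scale_map (qweyl q) c (qweyl_H q)"
  define e where "e r = const c * free_H r" for r :: "(generator, 'k) free_alg"
  define ev where "ev w = c * word_weight w" for w :: "generator free_monoid"
  have lookup_iterate: "Poly_Mapping.lookup ((e ^^ n) r) w = ev w ^ n * Poly_Mapping.lookup r w" for n r w
    by (induction n) (simp_all add: e_def ev_def lookup_const_mult lookup_free_H)
  have iterate: "(?D ^^ n) a = qweyl_class q ((e ^^ n) p)" for n
    unfolding a by (rule iterate_qweyl_lift) (simp add: scale_qweyl_H e_def)
  define chi where "chi = (\<Prod>w\<in>Poly_Mapping.keys p. [:- ev w, 1:])"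
  define N where "N = Polynomial.degree chi"
  have monic: "poly.coeff chi N = 1"
    unfolding N_def chi_def by (simp add: lead_coeff_prod)
  have annihilates: "(\<Sum>k\<le>N. const (poly.coeff chi k) * (e ^^ (k + j)) p) = 0" for j
  proof (rule poly_mapping_eqI)
    fix w
    have "Poly_Mapping.lookup (\<Sum>k\<le>N. const (poly.coeff chi k) * (e ^^ (k + j)) p) w =
        ev w ^ j * (poly chi (ev w) * Poly_Mapping.lookup p w)"
      by (simp add: lookup_sum lookup_const_mult lookup_iterate poly_altdef N_def power_add
          sum_distrib_left sum_distrib_right mult_ac)
    also have "poly chi (ev w) * Poly_Mapping.lookup p w = 0"
      by (cases "w \<in> Poly_Mapping.keys p") (auto simp: chi_def poly_prod in_keys_iff)
    finally show "Poly_Mapping.lookup (\<Sum>k\<le>N. const (poly.coeff chi k) * (e ^^ (k + j)) p) w =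
        Poly_Mapping.lookup 0 w" by simp
  qed
  let ?B = "(\<lambda>n. (?D ^^ n) a) ` {..<N}"
  let ?O = "{(?D ^^ n) a | n. n \<ge> 0}"
  have "(?D ^^ n) a \<in> V" if V: "submodule V ring_of_type_algebra (qweyl q)" "?B \<subseteq> V" for n V
  proof (induction n rule: less_induct)
    case (less n)
    show ?case
    proof (cases "n < N")
      case False
      then obtain j where n: "n = N + j" by (metis le_Suc_ex not_less)
      have "(e ^^ n) p = (\<Sum>k<N. const (- poly.coeff chi k) * (e ^^ (k + j)) p)"
        using annihilates[of j]
        by (simp add: n lessThan_Suc_atMost[symmetric] monic const_one const_def[of "- _"] single_uminus
            sum_negf add_eq_0_iff flip: const_def)
      moreover have "qweyl_class q (\<Sum>k<N. const (- poly.coeff chi k) * (e ^^ (k + j)) p) \<in> V"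
        using less by (intro qweyl_submodule_sum[OF V(1)] qweyl_submodule_closed(3)[OF V(1)])
          (simp add: iterate n)
      ultimately show ?thesis by (simp add: iterate)
    qed (use V(2) in auto)
  qed
  then have "lin_span (qweyl q) ?O \<subseteq> lin_span (qweyl q) ?B"
    unfolding lin_span_def by blast
  moreover have "lin_span (qweyl q) ?B \<subseteq> lin_span (qweyl q) ?O"
    unfolding lin_span_def by blast
  ultimately have "lin_span (qweyl q) ?O = lin_span (qweyl q) ?B" by blast
  moreover have "finite ?B" "?B \<subseteq> carrier (qweyl q)"
    by (auto simp: iterate qweyl_class_carrier)
  ultimately show "finite_dim (qweyl q) (lin_span (qweyl q) ?O)"
    unfolding finite_dim_def by blast
qed

lemma scale_H_locally_nilpotent_iff:
  "locally_nilpotent (qweyl q) (scale_map (qweyl q) c (qweyl_H q)) \<longleftrightarrow> c = 0"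
proof
  let ?D = "scale_map (qweyl q) c (qweyl_H q)"
  assume "locally_nilpotent (qweyl q) ?D"
  then obtain n where n: "(?D ^^ n) (qweyl_class q (var GenX)) = \<zero>\<^bsub>qweyl q\<^esub>"
    using qweyl_class_carrier[of q "var GenX"] by (auto simp: locally_nilpotent_def)
  have "(?D ^^ n) (qweyl_class q (var GenX)) = qweyl_class q (const (c ^ n) * var GenX)" for n
  proof (induction n)
    case (Suc n)
    have "const c * free_H (const (c ^ n) * var GenX) = const (c ^ Suc n) * var GenX"
      by (simp add: free_H_mult free_H_const free_H_var const_mult mult.assoc)
    then show ?case by (simp add: Suc scale_qweyl_H)
  qed (simp add: const_one)
  then have "symbol (const (c ^ n) * var GenX) = symbol 0"
    using n by (simp add: qweyl_zero qweyl_class_eq_iff)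
  then have "symbol (const (c ^ n) * var GenX) 1 = symbol 0 1" by (rule fun_cong)
  then show "c = 0" by (simp add: symbol_const_mult symbol_var symbol_zero)
next
  assume "c = 0"
  then show "locally_nilpotent (qweyl q) (scale_map (qweyl q) c (qweyl_H q))"
    by (auto simp: locally_nilpotent_def carrier_qweyl scale_qweyl_H qweyl_zero const_def
        intro!: exI[of _ 1])
qed

lemma scale_zero_H: "scale_map (qweyl q) 0 (qweyl_H q) = zero_map (qweyl q)"
proof
  fix a
  show "scale_map (qweyl q) 0 (qweyl_H q) a = zero_map (qweyl q) a"
  proof (cases "a \<in> carrier (qweyl q)")
    case True
    then show ?thesis by (auto simp: carrier_qweyl scale_qweyl_H zero_map_def qweyl_zero const_def)
  next
    case False
    then show ?thesis by (simp add: scale_map_def zero_map_def)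
  qed
qed

end

theorem proposition8:
  fixes q :: "'k::{alg_closed_field, field_char_0}"
  assumes "q \<noteq> 0" and "q \<noteq> 1"
  shows "(\<forall>D \<in> derivations (qweyl q).
            locally_finite (qweyl q) D \<longleftrightarrow> (\<exists>c. D = scale_map (qweyl q) c (qweyl_H q))) \<and>
         LFD (qweyl q) = {scale_map (qweyl q) c (qweyl_H q) | c. True} \<and>
         LND (qweyl q) = {zero_map (qweyl q)}"
proof -
  interpret quantum_weyl q by standard (use assms in auto)
  have lf: "\<forall>D \<in> derivations (qweyl q).
      locally_finite (qweyl q) D \<longleftrightarrow> (\<exists>c. D = scale_map (qweyl q) c (qweyl_H q))"
    using locally_finite_imp_scale_H scale_H_locally_finite by blast
  moreover have "LFD (qweyl q) = {scale_map (qweyl q) c (qweyl_H q) | c. True}"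
    using lf scale_qweyl_H_derivation by (auto simp: LFD_def)
  moreover have "LND (qweyl q) = {zero_map (qweyl q)}"
  proof (rule antisym)
    show "LND (qweyl q) \<subseteq> {zero_map (qweyl q)}"
    proof
      fix D assume D: "D \<in> LND (qweyl q)"
      then have "locally_finite (qweyl q) D"
        by (auto simp: LND_def intro: locally_nilpotent_imp_locally_finite)
      then obtain c where "D = scale_map (qweyl q) c (qweyl_H q)"
        using D lf by (auto simp: LND_def)
      then show "D \<in> {zero_map (qweyl q)}"
        using D scale_H_locally_nilpotent_iff[of c] by (simp add: LND_def scale_zero_H)
    qed
    show "{zero_map (qweyl q)} \<subseteq> LND (qweyl q)"
      using scale_qweyl_H_derivation[of 0] scale_H_locally_nilpotent_iff[of 0]
      by (simp add: LND_def scale_zero_H)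
  qed
  ultimately show ?thesis by blast
qed

end
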